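(* Let $x_*$ be a locally optimal solution of the problem $(\mathcal{P})$, let the functions $f_k$, $k\in M$, and $G$ be twice Fréchet differentiable at $x_*$, and let a complete alternance exist at $x_*$. Suppose also that assumptions (A2), (A4), (A10) and (A11) listed in the context are satisfied, and that the function $\Phi(G(x),\lambda,c)$ admits the second order expansion in $x$ at $(x_*,\lambda)$ for any $\lambda\in K^*$ such that $\langle\lambda,G(x_* )\rangle=0$. Then there exists $\lambda_*\in K^*$ such that $(x_*,\lambda_* )$ is a local saddle point of the augmented Lagrangian $\mathscr{L}(x,\lambda,c)$. Furthermore, under these assumptions, for any KKT-pair $(x_*,\mu_* )$ of the problem $(\mathcal{P})$ and for all $\lambda_*\in\Phi_0^{-1}(\mu_* )$ the pair $(x_*,\lambda_* )$ is a local saddle point of $\mathscr{L}(x,\lambda,c)$.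
   Context: Setting. $X=\mathbb{R}^d$, $A\subseteq X$ is a nonempty convex set, $Y$ is a normed space with dual $Y^*$ and pairing $\langle\cdot,\cdot\rangle$, $K\subseteq Y$ is a nonempty closed convex cone, $K^*=\{y^*\in Y^*\mid\langle y^*,y\rangle\le 0\ \forall y\in K\}$. $f=\max_{k\in M}f_k$ with $M=\{1,\dots,m\}$, $f_k:\mathbb{R}^d\to\mathbb{R}\cup\{+\infty\}$, and $G:X\to Y$. Problem $(\mathcal{P})$: minimize $f(x)$ subject to $G(x)\in K$, $x\in A$; there is a feasible point with $f(x)<+\infty$ and a globally optimal solution exists. $\Lambda\subseteq Y^*$ is a given closed convex cone. $\Phi:Y\times Y^*\times(0,+\infty)\to\mathbb{R}\cup\{+\infty\}$, and $\mathscr{L}(x,\lambda,c)=f(x)+\Phi(G(x),\lambda,c)$. Assumptions: (A2) $\Phi(y,\lambda,c)\le 0$ for all $y\in K$, $\lambda\in\Lambda$, $c>0$. (A4) $c\mapsto\Phi(y,\lambda,c)$ is non-decreasing for all $y\in Y$, $\lambda\in\Lambda$. (A10) $\Phi(y,\lambda,c)=0$ for all $y\in K$, $\lambda\in K^*$, $c>0$ with $\langle\lambda,y\rangle=0$. (A11) for all $y\in K$, $\lambda\in K^*$, $c>0$ with $\langle\lambda,y\rangle=0$ the function $\Phi(\cdot,\lambda,c)$ is Fréchet differentiable at $y$ with $D_y\Phi(y,\lambda,c)=\Phi_0(\lambda)$, where $\Phi_0:K^*\to K^*$ is a surjective mapping not depending on $y$ and $c$ such that $\langle\Phi_0(\lambda),y\rangle=0$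 iff $\langle\lambda,y\rangle=0$. Local saddle point: $(x_*,\lambda_* )\in A\times\Lambda$ such that for some $c_0>0$ and a neighbourhood $U$ of $x_*$, for all $c\ge c_0$: $\mathscr{L}(x_*,\lambda_*,c)<+\infty$ and $\sup_{\lambda\in\Lambda}\mathscr{L}(x_*,\lambda,c)\le\mathscr{L}(x_*,\lambda_*,c)\le\inf_{x\in U\cap A}\mathscr{L}(x,\lambda_*,c)$. KKT notions. $L(x,\lambda)=f(x)+\langle\lambda,G(x)\rangle$; $M(x)=\{k\in M\mid f_k(x)=f(x)\}$; $T_A(x)$, $T_K(y)$ are contingent cones. $(x_*,\mu_* )$ with $x_*\in A$ is a KKT-pair if $G(x_* )\in K$, $\mu_*\in K^*$, $\langle\mu_*,G(x_* )\rangle=0$ and the directional derivative satisfies $[L(\cdot,\mu_* )]'(x_*,h)\ge 0$ for all $h\in T_A(x_* )$. The critical cone is $C(x_*,\mu_* )=\{h\in T_A(x_* )\mid DG(x_* )h\in T_K(G(x_* )),\ \langle\mu_*,DG(x_* )h\rangle=0\}$. $\mathcal{T}(h)=T_K^2(G(x_* ),DG(x_* )h)$, where $T^2_K(y,v)=\{w\mid\exists t_n\downarrow 0:\ \mathrm{dist}(y+t_nv+\tfrac12t_n^2w,K)=o(t_n^2)\}$ is the outer second order tangent set, and $\sigma(\mu,\mathcal{T}(h))=\sup_{y\in\mathcal{T}(h)}\langle\mu,y\rangle$. Complete alternance. Let $N_A(x_* )=\{z\in\mathbb{R}^d\mid\langle z,h\rangle\le 0\ \forall h\in T_A(x_* )\}$,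 and let $[DG(x_* )]^*:Y^*\to\mathbb{R}^d$ be the adjoint of $DG(x_* )$ (identifying $(\mathbb{R}^d)^*$ with $\mathbb{R}^d$). A complete ($(d+1)$-point) alternance exists at $x_*$ if there are $k_0\in\{1,\dots,d+1\}$, $i_0\in\{k_0,\dots,d+1\}$ and vectors $V_1,\dots,V_{k_0}\in\{\nabla f_k(x_* )\mid k\in M(x_* )\}$, $V_{k_0+1},\dots,V_{i_0}\in[DG(x_* )]^*(\{y^*\in K^*\mid\langle y^*,G(x_* )\rangle=0\})$, $V_{i_0+1},\dots,V_{d+1}\in N_A(x_* )$ such that the $d\times d$ determinants $\Delta_s$ of the matrices with columns $V_1,\dots,V_{s-1},V_{s+1},\dots,V_{d+1}$ satisfy $\Delta_s\ne 0$ for $s\in\{1,\dots,d+1\}$ and $\mathrm{sign}\,\Delta_s=-\mathrm{sign}\,\Delta_{s+1}$ for $s\in\{1,\dots,d\}$. Second order expansion in $x$. Let (A11) hold, $G$ be twice Fréchet differentiable at a feasible point $x_*$, $\lambda_*\in K^*$, $\langle\lambda_*,G(x_* )\rangle=0$, $\mu_*=\Phi_0(\lambda_* )$. $\Phi(G(x),\lambda,c)$ admits the second order expansion in $x$ at $(x_*,\lambda_* )$ if for every $c>0$ there is a positively homogeneous of degree $2$ function $\omega_c:X\to\mathbb{R}$ such that for any $h$ in a neighbourhood of zero and $c>0$, $\Phi(G(x_*+h),\lambda_*,c)-\Phi(G(x_* ),\lambda_*,c)=\langle\mu_*,DG(x_* )h\rangle+\tfrac12\langle\mu_*,D^2G(x_*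 )(h,h)\rangle+\tfrac12\omega_c(h)+o(\|h\|^2)$, where $o(\|h\|^2)/\|h\|^2\to 0$ as $h\to 0$, and: (i) $\omega_c(h)\to-\sigma(\mu_*,\mathcal{T}(h))$ as $c\to+\infty$ for any $h\in C(x_*,\mu_* )$; (ii) if the joint upper limit $\limsup_{[h,c]\to[h_*,+\infty]}\omega_c(h)$ (as $h\to h_*$ and $c\to+\infty$) is finite for some $h_*\in T_A(x_* )$, then $h_*\in C(x_*,\mu_* )$ and $\limsup_{[h,c]\to[h_*,+\infty]}\omega_c(h)\ge-\sigma(\mu_*,\mathcal{T}(h_* ))$.
   Formalization: Added: K* ⊆ Λ (false e.g. for Λ={0}, K={0}, f(x)=G(x)=x). In (ii) the upper limit is taken along all sequences h_n→h_*, c_n→+∞; with the single joint upper limit the claim fails (f=x1+|x2|, G=id, K={0}, ω_c(h)=c·h2²−h1²). *)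

theory Defs
  imports "HOL-Analysis.Analysis"
begin

section \<open>Cones and tangent sets\<close>

definition polar_cone :: "'y::real_normed_vector set \<Rightarrow> ('y \<Rightarrow>\<^sub>L real) set" where
  "polar_cone K = {ys. \<forall>y\<in>K. blinfun_apply ys y \<le> 0}"

definition contingent_cone :: "'a::real_normed_vector set \<Rightarrow> 'a \<Rightarrow> 'a set" where
  "contingent_cone S x =
     {v. \<exists>t w. (\<forall>n. 0 < t n) \<and> t \<longlonglongrightarrow> (0::real) \<and> w \<longlonglongrightarrow> v \<and>
               (\<forall>n::nat. x + t n *\<^sub>R w n \<in> S)}"

definition second_order_tangent_set ::
    "'y::real_normed_vector set \<Rightarrow> 'y \<Rightarrow> 'y \<Rightarrow> 'y set" where
  "second_order_tangent_set K y v =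
     {w. \<exists>t. (\<forall>n::nat. 0 < t n) \<and> t \<longlonglongrightarrow> (0::real) \<and>
             (\<lambda>n. infdist (y + t n *\<^sub>R v + ((t n)\<^sup>2 / 2) *\<^sub>R w) K / (t n)\<^sup>2) \<longlonglongrightarrow> 0}"

definition normal_cone :: "(real ^ 'd) set \<Rightarrow> real ^ 'd \<Rightarrow> (real ^ 'd) set" where
  "normal_cone A x = {z. \<forall>h\<in>contingent_cone A x. z \<bullet> h \<le> 0}"

text \<open>Extended-valued, so that the supremum over the empty set is \<open>-\<infinity>\<close>.\<close>

definition support_fun :: "('y::real_normed_vector \<Rightarrow>\<^sub>L real) \<Rightarrow> 'y set \<Rightarrow> ereal" where
  "support_fun \<mu> S = (SUP y\<in>S. ereal (blinfun_apply \<mu> y))"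


section \<open>Second order differentiability\<close>

text \<open>\<open>D1\<close> and \<open>D2\<close> are the first and second Frechet derivatives of \<open>g\<close> at \<open>x\<close>; they are
  uniquely determined by \<open>g\<close> and \<open>x\<close>.\<close>

definition has_second_derivative_at ::
    "('a::real_normed_vector \<Rightarrow> 'b::real_normed_vector) \<Rightarrow> ('a \<Rightarrow>\<^sub>L 'b) \<Rightarrow>
     ('a \<Rightarrow>\<^sub>L 'a \<Rightarrow>\<^sub>L 'b) \<Rightarrow> 'a \<Rightarrow> bool" where
  "has_second_derivative_at g D1 D2 x \<longleftrightarrow>
     (\<exists>D. D x = D1 \<and>
          (\<forall>\<^sub>F z in nhds x. (g has_derivative blinfun_apply (D z)) (at z)) \<and>
          (D has_derivative blinfun_apply D2) (at x))"

text \<open>An extended-valued function differentiable at a point is finite near that point.\<close>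

definition twice_differentiable_ereal_at ::
    "('a::real_normed_vector \<Rightarrow> ereal) \<Rightarrow> 'a \<Rightarrow> bool" where
  "twice_differentiable_ereal_at g x \<longleftrightarrow>
     (\<forall>\<^sub>F z in nhds x. \<bar>g z\<bar> \<noteq> \<infinity>) \<and>
     (\<exists>D1 D2. has_second_derivative_at (\<lambda>z. real_of_ereal (g z)) D1 D2 x)"


section \<open>The problem\<close>

definition max_fun :: "nat \<Rightarrow> (nat \<Rightarrow> 'x \<Rightarrow> ereal) \<Rightarrow> 'x \<Rightarrow> ereal" where
  "max_fun m f x = Max ((\<lambda>k. f k x) ` {1..m})"

definition active_indices :: "nat \<Rightarrow> (nat \<Rightarrow> 'x \<Rightarrow> ereal) \<Rightarrow> 'x \<Rightarrow> nat set" where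
  "active_indices m f x = {k \<in> {1..m}. f k x = max_fun m f x}"

definition feasible_set :: "'x set \<Rightarrow> ('x \<Rightarrow> 'y) \<Rightarrow> 'y set \<Rightarrow> 'x set" where
  "feasible_set A G K = {x \<in> A. G x \<in> K}"

definition globally_optimal :: "('x \<Rightarrow> ereal) \<Rightarrow> 'x set \<Rightarrow> 'x \<Rightarrow> bool" where
  "globally_optimal F S x \<longleftrightarrow> x \<in> S \<and> F x < \<infinity> \<and> (\<forall>z\<in>S. F x \<le> F z)"

definition locally_optimal ::
    "('x::topological_space \<Rightarrow> ereal) \<Rightarrow> 'x set \<Rightarrow> 'x \<Rightarrow> bool" where
  "locally_optimal F S x \<longleftrightarrow>
     x \<in> S \<and> F x < \<infinity> \<and> (\<exists>U. open U \<and> x \<in> U \<and> (\<forall>z\<in>U \<inter> S. F x \<le> F z))"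

definition lagrangian ::
    "('x \<Rightarrow> ereal) \<Rightarrow> ('x \<Rightarrow> 'y::real_normed_vector) \<Rightarrow> 'x \<Rightarrow> ('y \<Rightarrow>\<^sub>L real) \<Rightarrow> ereal" where
  "lagrangian F G x \<nu> = F x + ereal (blinfun_apply \<nu> (G x))"

definition augmented_lagrangian ::
    "('x \<Rightarrow> ereal) \<Rightarrow> ('x \<Rightarrow> 'y) \<Rightarrow> ('y \<Rightarrow> 'l \<Rightarrow> real \<Rightarrow> ereal) \<Rightarrow>
     'x \<Rightarrow> 'l \<Rightarrow> real \<Rightarrow> ereal" where
  "augmented_lagrangian F G \<Phi> x \<nu> c = F x + \<Phi> (G x) \<nu> c"

definition local_saddle_point ::
    "'x::topological_space set \<Rightarrow> 'l set \<Rightarrow> ('x \<Rightarrow> 'l \<Rightarrow> real \<Rightarrow> ereal) \<Rightarrow>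
     'x \<Rightarrow> 'l \<Rightarrow> bool" where
  "local_saddle_point A \<Lambda> \<L> x\<^sub>0 \<nu>\<^sub>0 \<longleftrightarrow>
     x\<^sub>0 \<in> A \<and> \<nu>\<^sub>0 \<in> \<Lambda> \<and>
     (\<exists>c\<^sub>0 > 0. \<exists>U. open U \<and> x\<^sub>0 \<in> U \<and>
        (\<forall>c\<ge>c\<^sub>0. \<L> x\<^sub>0 \<nu>\<^sub>0 c < \<infinity> \<and>
                 (SUP \<nu>\<in>\<Lambda>. \<L> x\<^sub>0 \<nu> c) \<le> \<L> x\<^sub>0 \<nu>\<^sub>0 c \<and>
                 \<L> x\<^sub>0 \<nu>\<^sub>0 c \<le> (INF x\<in>U \<inter> A. \<L> x \<nu>\<^sub>0 c)))"

definition has_directional_derivative ::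
    "('x::real_normed_vector \<Rightarrow> ereal) \<Rightarrow> ereal \<Rightarrow> 'x \<Rightarrow> 'x \<Rightarrow> bool" where
  "has_directional_derivative g l x h \<longleftrightarrow>
     ((\<lambda>t. (g (x + t *\<^sub>R h) - g x) / ereal t) \<longlongrightarrow> l) (at_right 0)"

definition KKT_pair ::
    "('x::real_normed_vector \<Rightarrow> ereal) \<Rightarrow> ('x \<Rightarrow> 'y::real_normed_vector) \<Rightarrow>
     'x set \<Rightarrow> 'y set \<Rightarrow> 'x \<Rightarrow> ('y \<Rightarrow>\<^sub>L real) \<Rightarrow> bool" where
  "KKT_pair F G A K x \<mu> \<longleftrightarrow>
     x \<in> A \<and> G x \<in> K \<and> \<mu> \<in> polar_cone K \<and> blinfun_apply \<mu> (G x) = 0 \<and>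
     (\<forall>h\<in>contingent_cone A x.
        \<exists>l. has_directional_derivative (\<lambda>z. lagrangian F G z \<mu>) l x h \<and> 0 \<le> l)"

definition critical_cone ::
    "'x::real_normed_vector set \<Rightarrow> 'y::real_normed_vector set \<Rightarrow> ('x \<Rightarrow> 'y) \<Rightarrow>
     ('x \<Rightarrow>\<^sub>L 'y) \<Rightarrow> 'x \<Rightarrow> ('y \<Rightarrow>\<^sub>L real) \<Rightarrow> 'x set" where
  "critical_cone A K G DG x \<mu> =
     {h \<in> contingent_cone A x.
        blinfun_apply DG h \<in> contingent_cone K (G x) \<and>
        blinfun_apply \<mu> (blinfun_apply DG h) = 0}"


section \<open>Complete alternance\<close>

definition dual_adjoint ::
    "((real ^ 'd) \<Rightarrow>\<^sub>L 'y::real_normed_vector) \<Rightarrow> ('y \<Rightarrow>\<^sub>L real) \<Rightarrow> real ^ 'd" where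
  "dual_adjoint T ys = (\<chi> i. blinfun_apply ys (blinfun_apply T (axis i 1)))"

lemma dual_adjoint_inner:
  "dual_adjoint T ys \<bullet> h = blinfun_apply ys (blinfun_apply T h)"
proof -
  have "h = (\<Sum>i\<in>UNIV. (h $ i) *\<^sub>R axis i 1)"
    by (simp add: vec_eq_iff axis_def if_distrib cong: if_cong)
  then have "blinfun_apply ys (blinfun_apply T h) =
      blinfun_apply ys (blinfun_apply T (\<Sum>i\<in>UNIV. (h $ i) *\<^sub>R axis i 1))"
    by simp
  also have "\<dots> = (\<Sum>i\<in>UNIV. h $ i * blinfun_apply ys (blinfun_apply T (axis i 1)))"
    by (simp add: blinfun.sum_right blinfun.scaleR_right)
  also have "\<dots> = dual_adjoint T ys \<bullet> h"
    by (simp add: dual_adjoint_def inner_vec_def mult.commute)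
  finally show ?thesis by simp
qed

text \<open>A numbering of the coordinates by \<open>1, \<dots>, d\<close>, needed because the columns of a matrix
  over a finite type have no order. Another numbering multiplies all the determinants below
  by one common sign, so the alternance condition does not depend on the choice.\<close>

definition coord_number :: "'d::finite \<Rightarrow> nat" where
  "coord_number = (SOME e. bij_betw e UNIV {1..CARD('d)})"

text \<open>Determinant of the matrix with columns \<open>V 1, \<dots>, V (s - 1), V (s + 1), \<dots>, V (d + 1)\<close>.\<close>

definition alternance_det :: "(nat \<Rightarrow> real ^ 'd) \<Rightarrow> nat \<Rightarrow> real" where
  "alternance_det V s =
     det (\<chi> (i::'d) (j::'d).
            V (if coord_number j < s then coord_number j else coord_number j + 1) $ i)"

definition complete_alternance ::
    "nat \<Rightarrow> (nat \<Rightarrow> real ^ 'd \<Rightarrow> ereal) \<Rightarrow> (real ^ 'd \<Rightarrow> 'y::real_normed_vector) \<Rightarrow>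
     ((real ^ 'd) \<Rightarrow>\<^sub>L 'y) \<Rightarrow> (real ^ 'd) set \<Rightarrow> 'y set \<Rightarrow> real ^ 'd \<Rightarrow> bool" where
  "complete_alternance m f G DG A K x \<longleftrightarrow>
     (\<exists>k\<^sub>0\<in>{1..CARD('d) + 1}. \<exists>i\<^sub>0\<in>{k\<^sub>0..CARD('d) + 1}. \<exists>V :: nat \<Rightarrow> real ^ 'd.
        (\<forall>i\<in>{1..k\<^sub>0}. V i \<in> {v. \<exists>k\<in>active_indices m f x.
                                   GDERIV (\<lambda>z. real_of_ereal (f k z)) x :> v}) \<and>
        (\<forall>i\<in>{k\<^sub>0 + 1..i\<^sub>0}. V i \<in> dual_adjoint DG `
                                   {ys \<in> polar_cone K. blinfun_apply ys (G x) = 0}) \<and>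
        (\<forall>i\<in>{i\<^sub>0 + 1..CARD('d) + 1}. V i \<in> normal_cone A x) \<and>
        (\<forall>s\<in>{1..CARD('d) + 1}. alternance_det V s \<noteq> 0) \<and>
        (\<forall>s\<in>{1..CARD('d)}. sgn (alternance_det V s) = - sgn (alternance_det V (s + 1))))"


section \<open>Assumptions on the augmenting function\<close>

definition assumption_A2 ::
    "('y \<Rightarrow> 'l \<Rightarrow> real \<Rightarrow> ereal) \<Rightarrow> 'y set \<Rightarrow> 'l set \<Rightarrow> bool" where
  "assumption_A2 \<Phi> K \<Lambda> \<longleftrightarrow> (\<forall>y\<in>K. \<forall>\<nu>\<in>\<Lambda>. \<forall>c>0. \<Phi> y \<nu> c \<le> 0)"

definition assumption_A4 :: "('y \<Rightarrow> 'l \<Rightarrow> real \<Rightarrow> ereal) \<Rightarrow> 'l set \<Rightarrow> bool" where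
  "assumption_A4 \<Phi> \<Lambda> \<longleftrightarrow> (\<forall>y. \<forall>\<nu>\<in>\<Lambda>. mono_on {0<..} (\<Phi> y \<nu>))"

definition assumption_A10 ::
    "('y::real_normed_vector \<Rightarrow> ('y \<Rightarrow>\<^sub>L real) \<Rightarrow> real \<Rightarrow> ereal) \<Rightarrow> 'y set \<Rightarrow> bool" where
  "assumption_A10 \<Phi> K \<longleftrightarrow>
     (\<forall>y\<in>K. \<forall>\<nu>\<in>polar_cone K. \<forall>c>0. blinfun_apply \<nu> y = 0 \<longrightarrow> \<Phi> y \<nu> c = 0)"

definition assumption_A11 ::
    "('y::real_normed_vector \<Rightarrow> ('y \<Rightarrow>\<^sub>L real) \<Rightarrow> real \<Rightarrow> ereal) \<Rightarrow>
     (('y \<Rightarrow>\<^sub>L real) \<Rightarrow> ('y \<Rightarrow>\<^sub>L real)) \<Rightarrow> 'y set \<Rightarrow> bool" where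
  "assumption_A11 \<Phi> \<Phi>\<^sub>0 K \<longleftrightarrow>
     \<Phi>\<^sub>0 ` polar_cone K = polar_cone K \<and>
     (\<forall>y\<in>K. \<forall>\<nu>\<in>polar_cone K. blinfun_apply (\<Phi>\<^sub>0 \<nu>) y = 0 \<longleftrightarrow> blinfun_apply \<nu> y = 0) \<and>
     (\<forall>y\<in>K. \<forall>\<nu>\<in>polar_cone K. \<forall>c>0. blinfun_apply \<nu> y = 0 \<longrightarrow>
        (\<forall>\<^sub>F z in nhds y. \<bar>\<Phi> z \<nu> c\<bar> \<noteq> \<infinity>) \<and>
        ((\<lambda>z. real_of_ereal (\<Phi> z \<nu> c)) has_derivative blinfun_apply (\<Phi>\<^sub>0 \<nu>)) (at y))"

text \<open>In the last clause the upper limit is taken along every way in which \<open>(h, c)\<close> tends to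
  \<open>(h\<^sub>*, \<infinity>)\<close>, that is, along every pair of sequences. This implies the same clause for the
  upper limit over the whole product filter. The latter would be too weak: for
  \<open>\<omega> c h = c * (h $ 2)\<^sup>2 - (h $ 1)\<^sup>2\<close> that upper limit is \<open>\<infinity>\<close> at every \<open>h\<^sub>*\<close>, even though
  \<open>\<omega>\<close> stays negative along \<open>h $ 2 = 0\<close>.\<close>

definition second_order_expansion ::
    "(real ^ 'd) set \<Rightarrow> 'y::real_normed_vector set \<Rightarrow> (real ^ 'd \<Rightarrow> 'y) \<Rightarrow>
     ((real ^ 'd) \<Rightarrow>\<^sub>L 'y) \<Rightarrow> ((real ^ 'd) \<Rightarrow>\<^sub>L (real ^ 'd) \<Rightarrow>\<^sub>L 'y) \<Rightarrow>
     ('y \<Rightarrow> ('y \<Rightarrow>\<^sub>L real) \<Rightarrow> real \<Rightarrow> ereal) \<Rightarrow> real ^ 'd \<Rightarrow>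
     ('y \<Rightarrow>\<^sub>L real) \<Rightarrow> ('y \<Rightarrow>\<^sub>L real) \<Rightarrow> bool" where
  "second_order_expansion A K G DG D2G \<Phi> x \<nu> \<mu> \<longleftrightarrow>
     (\<exists>\<omega> :: real \<Rightarrow> real ^ 'd \<Rightarrow> real.
        (\<forall>c>0.
           (\<forall>t>0. \<forall>h. \<omega> c (t *\<^sub>R h) = t\<^sup>2 * \<omega> c h) \<and>
           (\<exists>r. (\<forall>\<^sub>F h in nhds 0.
                   \<Phi> (G (x + h)) \<nu> c - \<Phi> (G x) \<nu> c =
                     ereal (blinfun_apply \<mu> (blinfun_apply DG h)
                       + blinfun_apply \<mu> (blinfun_apply (blinfun_apply D2G h) h) / 2
                       + \<omega> c h / 2 + r h)) \<and>
                ((\<lambda>h. r h / (norm h)\<^sup>2) \<longlongrightarrow> 0) (at 0))) \<and>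
        (\<forall>h\<in>critical_cone A K G DG x \<mu>.
           ((\<lambda>c. ereal (\<omega> c h)) \<longlongrightarrow>
              - support_fun \<mu> (second_order_tangent_set K (G x) (blinfun_apply DG h))) at_top) \<and>
        (\<forall>h\<^sub>0\<in>contingent_cone A x. \<forall>(h :: nat \<Rightarrow> real ^ 'd) (c :: nat \<Rightarrow> real).
           h \<longlonglongrightarrow> h\<^sub>0 \<longrightarrow> filterlim c at_top sequentially \<longrightarrow>
           \<bar>limsup (\<lambda>n. ereal (\<omega> (c n) (h n)))\<bar> \<noteq> \<infinity> \<longrightarrow>
             h\<^sub>0 \<in> critical_cone A K G DG x \<mu> \<and>
             limsup (\<lambda>n. ereal (\<omega> (c n) (h n))) \<ge>
               - support_fun \<mu> (second_order_tangent_set K (G x) (blinfun_apply DG h\<^sub>0))))"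

end

(*
  Neighbouring determinants of the alternance differ in one column, so by Cramer's rule the
  alternating signs say that some combination of V_1, ..., V_(d+1) with positive coefficients
  vanishes.  Normalising the coefficients of the gradients of the f_k yields a multiplier, hence a
  KKT-pair.  Moreover no h other than 0 satisfies <V_i, h> <= 0 for all i, so for every nonzero
  critical direction h some active f_k has a positive derivative along h.

  If (x, \<nu>) were not a local saddle point, monotonicity in c would give points x + h_n of A tending to
  x at which the augmented Lagrangian with parameter n + 1 is below f(x).  With the unit vectors
  u_n = h_n / |h_n|, the KKT inequality bounds \<omega>_(n+1) (u_n) from above, and comparison with c = 1
  bounds it from below.  By part (ii) of the second order expansion every limit point of u_n is
  critical, but dividing the violated inequality by |h_n| shows that no active f_k increases along it.
*)
theory Submission
  imports Defs
begin

section \<open>Alternance determinants and positive linear dependencies\<close>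

lemma bij_betw_coord_number: "bij_betw (coord_number :: 'd::finite \<Rightarrow> nat) UNIV {1..CARD('d)}"
proof -
  have "\<exists>e. bij_betw e (UNIV :: 'd set) {1..CARD('d)}"
    by (rule finite_same_card_bij) auto
  then show ?thesis unfolding coord_number_def by (rule someI_ex)
qed

text \<open>Isolates the index expression inside \<open>alternance_det\<close>: skipping
  \<open>s\<close> turns the coordinate numbering into a bijection onto the d + 1 indices without
  \<open>s\<close>, so that sums over columns become sums over the remaining vectors.\<close>

definition column_index :: "nat \<Rightarrow> 'd::finite \<Rightarrow> nat" where
  "column_index s j = (if coord_number j < s then coord_number j else coord_number j + 1)"

definition alternance_matrix :: "(nat \<Rightarrow> real ^ 'd) \<Rightarrow> nat \<Rightarrow> real ^ 'd ^ 'd" where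
  "alternance_matrix V s = (\<chi> i j. V (column_index s j) $ i)"

lemma alternance_det_eq: "alternance_det V s = det (alternance_matrix V s)"
  by (simp add: alternance_det_def alternance_matrix_def column_index_def)

lemma bij_betw_column_index:
  assumes "s \<in> {1..CARD('d::finite) + 1}"
  shows "bij_betw (column_index s :: 'd \<Rightarrow> nat) UNIV ({1..CARD('d) + 1} - {s})"
proof -
  have "bij_betw (\<lambda>i. if i < s then i else i + 1) {1..CARD('d)} ({1..CARD('d) + 1} - {s})"
    by (rule bij_betw_byWitness[where f' = "\<lambda>i. if i < s then i else i - 1"]) (use assms in auto)
  from bij_betw_trans[OF bij_betw_coord_number this]
  show ?thesis by (simp add: column_index_def[abs_def] comp_def)
qed

text \<open>Links linear relations among the vectors to linear systems with the matrix of a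
  determinant, the form in which invertibility and Cramer's rule apply.\<close>

lemma alternance_matrix_mult:
  fixes V :: "nat \<Rightarrow> real ^ 'd" and a :: "nat \<Rightarrow> real"
  assumes "s \<in> {1..CARD('d) + 1}"
  shows "alternance_matrix V s *v (\<chi> j. a (column_index s j)) =
    (\<Sum>i\<in>{1..CARD('d) + 1} - {s}. a i *\<^sub>R V i)"
proof -
  have "alternance_matrix V s *v (\<chi> j. a (column_index s j)) =
      (\<Sum>j\<in>(UNIV :: 'd set). a (column_index s j) *\<^sub>R V (column_index s j))"
    by (simp add: matrix_vector_mult_def alternance_matrix_def vec_eq_iff sum_component mult.commute)
  also have "\<dots> = (\<Sum>i\<in>{1..CARD('d) + 1} - {s}. a i *\<^sub>R V i)"
    by (rule sum.reindex_bij_betw[OF bij_betw_column_index[OF assms]])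
  finally show ?thesis .
qed

text \<open>The matrices of \<open>\<Delta>\<^sub>s\<close> and \<open>\<Delta>\<^sub>s\<^sub>+\<^sub>1\<close> differ in the \<open>s\<close>-th column only, so Cramer's rule
  compares the two determinants without any permutation signs.\<close>

lemma alternance_det_step:
  fixes V :: "nat \<Rightarrow> real ^ 'd" and a :: "nat \<Rightarrow> real"
  assumes s: "s \<in> {1..CARD('d)}" and dep: "(\<Sum>i\<in>{1..CARD('d) + 1}. a i *\<^sub>R V i) = 0"
  shows "a s * alternance_det V (s + 1) = - (a (s + 1) * alternance_det V s)"
proof -
  obtain k :: 'd where k: "coord_number k = s"
    using s bij_betw_imp_surj_on[OF bij_betw_coord_number[where 'd = 'd]] by (metis imageE)
  have inj: "coord_number j = s \<longleftrightarrow> j = k" for j :: 'd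
    using bij_betw_coord_number[where 'd = 'd] k by (auto simp: bij_betw_def inj_on_def)
  \<comment> \<open>In position \<open>k\<close> the matrix \<open>?A\<close> has the column
    \<open>V s\<close> and \<open>?B\<close> has the column \<open>V (s + 1)\<close>; in all other
    positions the two index maps agree.\<close>
  let ?A = "alternance_matrix V (s + 1)" and ?B = "alternance_matrix V s"
  let ?x = "\<chi> j. a (column_index (s + 1) j)"
  have "(\<Sum>i\<in>{1..CARD('d) + 1}. a i *\<^sub>R V i)
      = a (s + 1) *\<^sub>R V (s + 1) + (\<Sum>i\<in>{1..CARD('d) + 1} - {s + 1}. a i *\<^sub>R V i)"
    by (rule sum.remove) (use s in auto)
  then have Ax: "?A *v ?x = - (a (s + 1) *\<^sub>R V (s + 1))"
    using dep s by (subst alternance_matrix_mult) (auto simp: eq_neg_iff_add_eq_0 add.commute)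
  \<comment> \<open>Column \<open>k\<close> of \<open>?B\<close> is \<open>V (s + 1)\<close>, so a
    multiple of the \<open>k\<close>-th unit vector solves the system with right-hand side
    \<open>?A *v ?x\<close>.\<close>
  have Bx: "?B *v axis k (- a (s + 1)) = - (a (s + 1) *\<^sub>R V (s + 1))"
    by (simp add: matrix_vector_mult_def alternance_matrix_def vec_eq_iff axis_def if_distrib
        column_index_def k cong: if_cong)
  \<comment> \<open>Cramer's rule is used for both matrices. Replacing column \<open>k\<close> by
    the common right-hand side yields the same matrix from \<open>?A\<close> and from
    \<open>?B\<close>.\<close>
  have "?x $ k * det ?A = det (\<chi> i j. if j = k then (?A *v ?x) $ i else ?A $ i $ j)"
    by (simp only: cramer_lemma)
  also have "\<dots> = det (\<chi> i j. if j = k then (?B *v axis k (- a (s + 1))) $ i else ?B $ i $ j)"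
  proof -
    have "?A $ i $ j = ?B $ i $ j" if "j \<noteq> k" for i j
      using that inj[of j] by (auto simp: alternance_matrix_def column_index_def)
    then show ?thesis unfolding Ax Bx by (intro arg_cong[where f = det]) (simp add: vec_eq_iff)
  qed
  also have "\<dots> = - a (s + 1) * det ?B"
    by (simp only: cramer_lemma) (simp add: axis_def)
  finally show ?thesis
    by (simp add: alternance_det_eq column_index_def k)
qed

text \<open>Invertibility of the last matrix gives a dependency with coefficient 1 at the last
  vector. \<open>alternance_det_step\<close> then passes positivity from \<open>a (s + 1)\<close> to
  \<open>a s\<close>: its minus sign is cancelled by the sign change of the determinants.\<close>

lemma alternance_positive_dependency:
  fixes V :: "nat \<Rightarrow> real ^ 'd"
  assumes nz: "\<And>s. s \<in> {1..CARD('d) + 1} \<Longrightarrow> alternance_det V s \<noteq> 0"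
    and alt: "\<And>s. s \<in> {1..CARD('d)} \<Longrightarrow>
      sgn (alternance_det V s) = - sgn (alternance_det V (s + 1))"
  obtains a where "\<And>i. i \<in> {1..CARD('d) + 1} \<Longrightarrow> 0 < a i"
    and "(\<Sum>i\<in>{1..CARD('d) + 1}. a i *\<^sub>R V i) = 0"
proof -
  let ?n = "CARD('d) + 1"
  let ?M = "alternance_matrix V ?n"
  have "invertible ?M"
    using nz[of ?n] by (simp add: alternance_det_eq invertible_det_nz)
  then obtain x where x: "?M *v x = - V ?n"
    by (metis invertible_def matrix_vector_mul_assoc matrix_vector_mul_lid)
  have bij: "bij_betw (column_index ?n :: 'd \<Rightarrow> nat) UNIV ({1..?n} - {?n})"
    by (rule bij_betw_column_index) auto
  \<comment> \<open>The solution \<open>x\<close> is indexed by columns; inverting the column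
    numbering turns it into coefficients for 1, ..., d, and the omitted last vector gets coefficient
    1.\<close>
  define a where "a i = (if i = ?n then 1 else x $ inv_into UNIV (column_index ?n) i)" for i
  have "a (column_index ?n j) = x $ j" for j :: 'd
    using bij by (auto simp: a_def bij_betw_def)
  then have "x = (\<chi> j. a (column_index ?n j))" by (simp add: vec_eq_iff)
  then have "?M *v x = (\<Sum>i\<in>{1..?n} - {?n}. a i *\<^sub>R V i)"
    by (simp only:) (rule alternance_matrix_mult, simp)
  with x have rest: "(\<Sum>i\<in>{1..?n} - {?n}. a i *\<^sub>R V i) = - V ?n" by simp
  have "(\<Sum>i\<in>{1..?n}. a i *\<^sub>R V i) = a ?n *\<^sub>R V ?n + (\<Sum>i\<in>{1..?n} - {?n}. a i *\<^sub>R V i)"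
    by (rule sum.remove) auto
  then have dep: "(\<Sum>i\<in>{1..?n}. a i *\<^sub>R V i) = 0"
    using rest by (simp add: a_def)
  \<comment> \<open>The induction descends from the last index. Index 0 belongs to no vector of the
    alternance, hence the guard \<open>1 \<le> i\<close>.\<close>
  have "1 \<le> i \<longrightarrow> 0 < a i" if "i \<le> ?n" for i
    using that
  proof (induction rule: inc_induct)
    case base
    show ?case by (simp add: a_def)
  next
    case (step s)
    show ?case
    proof
      assume "1 \<le> s"
      with step have s: "s \<in> {1..CARD('d)}" and pos: "0 < a (Suc s)" by auto
      have eq: "a s * alternance_det V (s + 1) = - (a (s + 1) * alternance_det V s)"
        by (rule alternance_det_step[OF s dep])
      have "alternance_det V (s + 1) \<noteq> 0" using nz s by auto
      \<comment> \<open>Taking signs in \<open>eq\<close> removes all magnitudes; as the determinant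
        is nonzero, its sign cancels and leaves \<open>sgn (a s) = 1\<close>.\<close>
      moreover have "sgn (a s) * sgn (alternance_det V (s + 1)) = sgn (alternance_det V (s + 1))"
        using arg_cong[OF eq, of sgn] alt[OF s] pos by (simp add: sgn_mult sgn_minus)
      ultimately show "0 < a s" by (simp add: sgn_if split: if_splits)
    qed
  qed
  with dep that show thesis by auto
qed

text \<open>Pairing the dependency with \<open>h\<close> gives a vanishing sum of terms of one sign,
  so every \<open>V i\<close> is orthogonal to \<open>h\<close>. The first d of these vectors are
  the columns of an invertible matrix and therefore span the space.\<close>

lemma alternance_nonpos_imp_zero:
  fixes V :: "nat \<Rightarrow> real ^ 'd"
  assumes nz: "\<And>s. s \<in> {1..CARD('d) + 1} \<Longrightarrow> alternance_det V s \<noteq> 0"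
    and pos: "\<And>i. i \<in> {1..CARD('d) + 1} \<Longrightarrow> 0 < a i"
    and dep: "(\<Sum>i\<in>{1..CARD('d) + 1}. a i *\<^sub>R V i) = 0"
    and h: "\<And>i. i \<in> {1..CARD('d) + 1} \<Longrightarrow> V i \<bullet> h \<le> 0"
  shows "h = 0"
proof -
  let ?n = "CARD('d) + 1"
  let ?M = "alternance_matrix V ?n"
  have "(\<Sum>i\<in>{1..?n}. - (a i * (V i \<bullet> h))) = 0"
    using arg_cong[OF dep, of "\<lambda>v. v \<bullet> h"]
    by (simp only: inner_sum_left sum_negf inner_scaleR_left inner_zero_left)
  moreover have "0 \<le> - (a i * (V i \<bullet> h))" if "i \<in> {1..?n}" for i
    using pos[OF that] h[OF that] by (simp add: mult_nonneg_nonpos)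
  ultimately have "\<forall>i\<in>{1..?n}. - (a i * (V i \<bullet> h)) = 0"
    by (subst (asm) sum_nonneg_eq_0_iff) auto
  then have zero: "V i \<bullet> h = 0" if "i \<in> {1..?n}" for i
    using pos that by fastforce
  have "column_index ?n j \<in> {1..?n}" for j :: 'd
    using bij_betw_apply[OF bij_betw_column_index[of ?n, where 'd = 'd], of j] by simp
  then have "transpose ?M *v h = 0"
    using zero by (simp add: vec_eq_iff matrix_vector_mult_def transpose_def
        alternance_matrix_def inner_vec_def)
  moreover have "invertible (transpose ?M)"
    using nz[of ?n] by (simp add: alternance_det_eq invertible_det_nz)
  ultimately show ?thesis
    by (metis invertible_def matrix_vector_mul_assoc matrix_vector_mul_lid matrix_vector_mult_0_right)
qed

section \<open>Polar and contingent cones\<close>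

lemma polar_cone_contingent_nonpos:
  assumes \<nu>: "\<nu> \<in> polar_cone K" and y: "blinfun_apply \<nu> y = 0"
    and v: "v \<in> contingent_cone K y"
  shows "blinfun_apply \<nu> v \<le> 0"
proof -
  obtain t w where t: "\<And>n. 0 < t n" and w: "w \<longlonglongrightarrow> v" and K: "\<And>n::nat. y + t n *\<^sub>R w n \<in> K"
    using v by (auto simp: contingent_cone_def)
  \<comment> \<open>As \<nu> vanishes at \<open>y\<close> and is nonpositive on \<open>K\<close>, it
    is nonpositive on the increments \<open>t n *\<^sub>R w n\<close>; the positive factor is
    divided out, and the sign survives the limit.\<close>
  have "blinfun_apply \<nu> (w n) \<le> 0" for n
  proof -
    have "blinfun_apply \<nu> (y + t n *\<^sub>R w n) \<le> 0"
      using \<nu> K by (auto simp: polar_cone_def)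
    then show ?thesis
      using t[of n] y by (simp add: blinfun.add_right blinfun.scaleR_right mult_le_0_iff)
  qed
  moreover have "(\<lambda>n. blinfun_apply \<nu> (w n)) \<longlonglongrightarrow> blinfun_apply \<nu> v"
    by (intro tendsto_intros w)
  ultimately show ?thesis
    by (meson LIMSEQ_le_const2)
qed

text \<open>The segment from \<open>x\<close> to \<open>z\<close> lies in \<open>A\<close>, so a
  constant direction sequence is a witness. This lets the KKT inequality, stated for tangent
  directions, be applied to actual displacements between points of \<open>A\<close>.\<close>

lemma convex_diff_in_contingent_cone:
  assumes "convex A" and "x \<in> A" and "z \<in> A"
  shows "z - x \<in> contingent_cone A x"
proof -
  have "x + inverse (real (Suc n)) *\<^sub>R (z - x) \<in> A" for n
  proof -
    have "inverse (real (Suc n)) \<le> 1" by (simp add: field_simps)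
    then have "(1 - inverse (real (Suc n))) *\<^sub>R x + inverse (real (Suc n)) *\<^sub>R z \<in> A"
      using assms by (intro convexD) auto
    then show ?thesis by (simp add: algebra_simps)
  qed
  then show ?thesis
    unfolding contingent_cone_def using LIMSEQ_inverse_real_of_nat
    by (auto intro!: exI[of _ "\<lambda>n. inverse (real (Suc n))"] exI[of _ "\<lambda>n. z - x"])
qed

section \<open>Directional derivatives of finite maxima\<close>

lemma tendsto_Max_image:
  fixes g :: "'k \<Rightarrow> 't \<Rightarrow> real"
  assumes "finite I" and "I \<noteq> {}" and "\<And>k. k \<in> I \<Longrightarrow> (g k \<longlongrightarrow> l k) F"
  shows "((\<lambda>t. Max ((\<lambda>k. g k t) ` I)) \<longlongrightarrow> Max (l ` I)) F"
  using assms
proof (induction rule: finite_ne_induct)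
  case (singleton k)
  then show ?case by simp
next
  case (insert k I)
  then have "((\<lambda>t. max (g k t) (Max ((\<lambda>k. g k t) ` I))) \<longlongrightarrow> max (l k) (Max (l ` I))) F"
    by (intro tendsto_max) auto
  with insert show ?case by simp
qed

lemma Max_ereal_image:
  fixes g :: "'k \<Rightarrow> real"
  assumes "finite I" and "I \<noteq> {}"
  shows "Max ((\<lambda>k. ereal (g k)) ` I) = ereal (Max (g ` I))"
  using mono_Max_commute[of ereal "g ` I"] assms by (simp add: mono_def image_image)

lemma has_derivative_ray:
  fixes g :: "'a::real_normed_vector \<Rightarrow> real"
  assumes "(g has_derivative D) (at x)"
  shows "((\<lambda>t. (g (x + t *\<^sub>R h) - g x) / t) \<longlongrightarrow> D h) (at_right 0)"
proof -
  have "((\<lambda>t::real. x + t *\<^sub>R h) has_derivative (\<lambda>t. t *\<^sub>R h)) (at 0)"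
    by (auto intro!: derivative_eq_intros)
  moreover have "(g has_derivative D) (at (x + 0 *\<^sub>R h))" using assms by simp
  ultimately have "((\<lambda>t::real. g (x + t *\<^sub>R h)) has_derivative (\<lambda>t. D (t *\<^sub>R h))) (at 0)"
    by (rule has_derivative_compose)
  moreover have "D (t *\<^sub>R h) = D h * t" for t
    using linear_scale[OF has_derivative_linear[OF assms]] by simp
  ultimately have "((\<lambda>t::real. g (x + t *\<^sub>R h)) has_field_derivative D h) (at 0)"
    by (simp add: has_field_derivative_def)
  then have "((\<lambda>t. (g (x + t *\<^sub>R h) - g x) / t) \<longlongrightarrow> D h) (at 0)"
    by (simp add: has_field_derivative_iff)
  then show ?thesis
    by (rule filterlim_mono) (auto simp: at_le)
qed

text \<open>For small \<open>t\<close> the inactive functions stay below an active one, so only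
  active functions compete in the maximum. These share the starting value \<open>F x\<close>, and
  the maximum commutes with the difference quotient and with the limit.\<close>

lemma directional_derivative_Max:
  fixes g :: "'k \<Rightarrow> 'a::real_normed_vector \<Rightarrow> real"
  assumes I: "finite I" "I \<noteq> {}"
    and D: "\<And>k. k \<in> I \<Longrightarrow> (g k has_derivative D k) (at x)"
  defines "F \<equiv> \<lambda>z. Max ((\<lambda>k. g k z) ` I)"
  shows "((\<lambda>t. (F (x + t *\<^sub>R h) - F x) / t) \<longlongrightarrow> Max ((\<lambda>k. D k h) ` {k \<in> I. g k x = F x}))
    (at_right 0)"
proof -
  let ?J = "{k \<in> I. g k x = F x}"
  have "F x \<in> (\<lambda>k. g k x) ` I" unfolding F_def by (intro Max_in) (use I in auto)
  then obtain k0 where k0: "k0 \<in> ?J" by auto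
  have J: "finite ?J" "?J \<noteq> {}" using I k0 by auto
  have ray: "((\<lambda>t::real. x + t *\<^sub>R h) \<longlongrightarrow> x) (at_right 0)"
    by (auto intro!: tendsto_eq_intros)
  have lim: "((\<lambda>t. g k (x + t *\<^sub>R h)) \<longlongrightarrow> g k x) (at_right 0)" if "k \<in> I" for k
    using isCont_tendsto_compose[OF has_derivative_continuous[OF D[OF that]] ray] .
  have "\<forall>\<^sub>F t in at_right 0. g j (x + t *\<^sub>R h) < g k0 (x + t *\<^sub>R h)" if "j \<in> I - ?J" for j
  proof (rule order_tendstoD(2)[THEN eventually_mp[rotated]])
    have "g j x \<le> F x" unfolding F_def by (intro Max_ge) (use I that in auto)
    then have *: "g j x - g k0 x < 0" using that k0 by auto
    show "((\<lambda>t. g j (x + t *\<^sub>R h) - g k0 (x + t *\<^sub>R h)) \<longlongrightarrow> g j x - g k0 x) (at_right 0)"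
      by (intro tendsto_diff lim) (use that k0 in auto)
    show "g j x - g k0 x < 0" by (rule *)
  qed auto
  then have "\<forall>\<^sub>F t in at_right 0. \<forall>j\<in>I - ?J. g j (x + t *\<^sub>R h) < g k0 (x + t *\<^sub>R h)"
    by (intro eventually_ball_finite) (use I in auto)
  then have "\<forall>\<^sub>F t in at_right 0.
      Max ((\<lambda>k. (g k (x + t *\<^sub>R h) - g k x) / t) ` ?J) = (F (x + t *\<^sub>R h) - F x) / t"
    using eventually_at_right_less[of "0::real"]
  proof eventually_elim
    case (elim t)
    have "F (x + t *\<^sub>R h) = Max ((\<lambda>k. g k (x + t *\<^sub>R h)) ` ?J)"
      unfolding F_def
    proof (rule Max_eq_if)
      show "\<forall>a\<in>(\<lambda>k. g k (x + t *\<^sub>R h)) ` I. \<exists>b\<in>(\<lambda>k. g k (x + t *\<^sub>R h)) `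
          {k \<in> I. g k x = Max ((\<lambda>k. g k x) ` I)}. a \<le> b"
      proof (rule ballI, elim imageE)
        fix a j assume a: "a = g j (x + t *\<^sub>R h)" and j: "j \<in> I"
        show "\<exists>b\<in>(\<lambda>k. g k (x + t *\<^sub>R h)) ` {k \<in> I. g k x = Max ((\<lambda>k. g k x) ` I)}. a \<le> b"
        proof (cases "j \<in> ?J")
          case True
          then show ?thesis using a unfolding F_def by blast
        next
          case False
          then have "a \<le> g k0 (x + t *\<^sub>R h)" using a j elim(1) by (simp add: less_imp_le)
          then show ?thesis using k0 unfolding F_def by blast
        qed
      qed
    qed (use I J in auto)
    \<comment> \<open>For positive \<open>t\<close> the map sending \<open>y\<close> to
      \<open>(y - F x) / t\<close> is monotone and so commutes with the maximum; on
      \<open>?J\<close> the value \<open>F x\<close> is then replaced by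
      \<open>g k x\<close>.\<close>
    also have "(\<dots> - F x) / t = Max ((\<lambda>y. (y - F x) / t) ` (\<lambda>k. g k (x + t *\<^sub>R h)) ` ?J)"
      using J elim(2)
      by (intro mono_Max_commute[of "\<lambda>y. (y - F x) / t"]) (auto simp: mono_def divide_right_mono)
    also have "(\<lambda>y. (y - F x) / t) ` (\<lambda>k. g k (x + t *\<^sub>R h)) ` ?J =
        (\<lambda>k. (g k (x + t *\<^sub>R h) - g k x) / t) ` ?J"
      by (force simp: image_image)
    finally show ?case by simp
  qed
  moreover have "((\<lambda>t. Max ((\<lambda>k. (g k (x + t *\<^sub>R h) - g k x) / t) ` ?J)) \<longlongrightarrow>
      Max ((\<lambda>k. D k h) ` ?J)) (at_right 0)"
    by (intro tendsto_Max_image J has_derivative_ray D) auto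
  ultimately show ?thesis
    by (rule Lim_transform_eventually[rotated])
qed

lemma active_indices_nonempty:
  assumes "1 \<le> m"
  shows "active_indices m f x \<noteq> {}"
proof -
  have "max_fun m f x \<in> (\<lambda>k. f k x) ` {1..m}"
    unfolding max_fun_def by (intro Max_in) (use assms in auto)
  then show ?thesis by (auto simp: active_indices_def)
qed

text \<open>Moves the objective from extended to real values near a point of finiteness, where
  calculus for real functions is available.\<close>

lemma eventually_max_fun_eq_ereal:
  assumes "1 \<le> m" and "\<And>k. k \<in> {1..m} \<Longrightarrow> \<forall>\<^sub>F z in N. \<bar>f k z\<bar> \<noteq> \<infinity>"
  shows "\<forall>\<^sub>F z in N. max_fun m f z = ereal (Max ((\<lambda>k. real_of_ereal (f k z)) ` {1..m}))"
proof -
  have "\<forall>\<^sub>F z in N. \<forall>k\<in>{1..m}. \<bar>f k z\<bar> \<noteq> \<infinity>"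
    by (intro eventually_ball_finite) (use assms in auto)
  then show ?thesis
  proof eventually_elim
    case (elim z)
    then have "max_fun m f z = Max ((\<lambda>k. ereal (real_of_ereal (f k z))) ` {1..m})"
      unfolding max_fun_def by (intro arg_cong[where f = Max] image_cong) (auto simp: ereal_real)
    also have "\<dots> = ereal (Max ((\<lambda>k. real_of_ereal (f k z)) ` {1..m}))"
      by (rule Max_ereal_image) (use assms(1) in auto)
    finally show ?case .
  qed
qed

lemma has_directional_derivative_lagrangian_max:
  fixes f :: "nat \<Rightarrow> 'a::real_normed_vector \<Rightarrow> ereal" and G :: "'a \<Rightarrow> 'y::real_normed_vector"
  assumes m: "1 \<le> m" and fin: "\<And>k. k \<in> {1..m} \<Longrightarrow> \<forall>\<^sub>F z in nhds x. \<bar>f k z\<bar> \<noteq> \<infinity>"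
    and D: "\<And>k. k \<in> {1..m} \<Longrightarrow> ((\<lambda>z. real_of_ereal (f k z)) has_derivative D k) (at x)"
    and G: "(G has_derivative blinfun_apply DG) (at x)"
  shows "has_directional_derivative (\<lambda>z. lagrangian (max_fun m f) G z \<mu>)
    (ereal (Max ((\<lambda>k. D k h) ` active_indices m f x) + blinfun_apply \<mu> (blinfun_apply DG h))) x h"
proof -
  let ?g = "\<lambda>k z. real_of_ereal (f k z)"
  let ?F = "\<lambda>z. Max ((\<lambda>k. ?g k z) ` {1..m})"
  have ev: "\<forall>\<^sub>F z in nhds x. max_fun m f z = ereal (?F z)"
    by (intro eventually_max_fun_eq_ereal m fin)
  then have Fx: "max_fun m f x = ereal (?F x)" by (rule eventually_nhds_x_imp_x)
  have active: "active_indices m f x = {k \<in> {1..m}. ?g k x = ?F x}"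
  proof -
    have "f k x = ereal (?F x) \<longleftrightarrow> ?g k x = ?F x" if "k \<in> {1..m}" for k
      using eventually_nhds_x_imp_x[OF fin[OF that]] by (cases "f k x") auto
    then show ?thesis unfolding active_indices_def Fx by blast
  qed
  have ray: "filterlim (\<lambda>t::real. x + t *\<^sub>R h) (nhds x) (at_right 0)"
    by (auto intro!: tendsto_eq_intros)
  have "((\<lambda>t. (?F (x + t *\<^sub>R h) - ?F x) / t) \<longlongrightarrow>
      Max ((\<lambda>k. D k h) ` active_indices m f x)) (at_right 0)"
    unfolding active by (rule directional_derivative_Max) (use m D in auto)
  moreover have "((\<lambda>z. blinfun_apply \<mu> (G z)) has_derivative
      (\<lambda>h. blinfun_apply \<mu> (blinfun_apply DG h))) (at x)"
    by (auto intro!: derivative_eq_intros G)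
  then have "((\<lambda>t. (blinfun_apply \<mu> (G (x + t *\<^sub>R h)) - blinfun_apply \<mu> (G x)) / t) \<longlongrightarrow>
      blinfun_apply \<mu> (blinfun_apply DG h)) (at_right 0)"
    by (rule has_derivative_ray)
  ultimately have lim: "((\<lambda>t. ereal ((?F (x + t *\<^sub>R h) - ?F x) / t +
      (blinfun_apply \<mu> (G (x + t *\<^sub>R h)) - blinfun_apply \<mu> (G x)) / t)) \<longlongrightarrow>
      ereal (Max ((\<lambda>k. D k h) ` active_indices m f x) + blinfun_apply \<mu> (blinfun_apply DG h)))
      (at_right 0)"
    by (intro tendsto_intros)
  \<comment> \<open>Close to \<open>x\<close> all values on the ray are finite, so the
    extended-valued difference quotient is the real one.\<close>
  have "\<forall>\<^sub>F t in at_right 0. ereal ((?F (x + t *\<^sub>R h) - ?F x) / t +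
      (blinfun_apply \<mu> (G (x + t *\<^sub>R h)) - blinfun_apply \<mu> (G x)) / t) =
      (lagrangian (max_fun m f) G (x + t *\<^sub>R h) \<mu> - lagrangian (max_fun m f) G x \<mu>) / ereal t"
    using filterlim_iff[THEN iffD1, OF ray, rule_format, OF ev]
      eventually_at_right_less[of "0::real"]
  proof eventually_elim
    case (elim t)
    then show ?case by (simp add: lagrangian_def Fx diff_divide_distrib add_divide_distrib)
  qed
  from Lim_transform_eventually[OF lim this] show ?thesis
    unfolding has_directional_derivative_def .
qed

section \<open>Quadratic estimates and local minimality of the augmented Lagrangian in x\<close>

lemma has_second_derivative_atD:
  assumes "has_second_derivative_at g D1 D2 x"
  shows "(g has_derivative blinfun_apply D1) (at x)"
proof -
  obtain D where "D x = D1" and "\<forall>\<^sub>F z in nhds x. (g has_derivative blinfun_apply (D z)) (at z)"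
    using assms unfolding has_second_derivative_at_def by auto
  then show ?thesis using eventually_nhds_x_imp_x by fastforce
qed

text \<open>The mean value inequality is applied to \<open>g\<close> minus its linearisation. The
  derivative of this difference is \<open>D z - D1\<close>, which is of order \<open>norm h\<close>
  on the ball of radius \<open>norm h\<close> because \<open>D\<close> is differentiable at
  \<open>x\<close>.\<close>

lemma second_derivative_quadratic_bound:
  fixes g :: "'a::real_normed_vector \<Rightarrow> 'b::real_normed_vector"
  assumes "has_second_derivative_at g D1 D2 x"
  obtains C \<delta> where "0 < \<delta>"
    and "\<And>h. norm h < \<delta> \<Longrightarrow> norm (g (x + h) - g x - blinfun_apply D1 h) \<le> C * (norm h)\<^sup>2"
proof -
  obtain D where Dx: "D x = D1"
    and g: "\<forall>\<^sub>F z in nhds x. (g has_derivative blinfun_apply (D z)) (at z)"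
    and D: "(D has_derivative blinfun_apply D2) (at x)"
    using assms unfolding has_second_derivative_at_def by auto
  obtain d1 where d1: "0 < d1"
    and g': "\<And>z. dist z x < d1 \<Longrightarrow> (g has_derivative blinfun_apply (D z)) (at z)"
    using g unfolding eventually_nhds_metric by auto
  obtain d2 where d2: "0 < d2"
    and D': "\<And>z. norm (z - x) < d2 \<Longrightarrow>
      norm (D z - D x - blinfun_apply D2 (z - x)) \<le> 1 * norm (z - x)"
    using D unfolding has_derivative_at_alt by (meson zero_less_one)
  \<comment> \<open>The summand 1 absorbs the first order remainder of \<open>D\<close>, taken with
    relative error 1 in \<open>D'\<close>.\<close>
  define C where "C = norm D2 + 1"
  have lip: "norm (D z - D x) \<le> C * norm (z - x)" if "norm (z - x) < d2" for z
    using D'[OF that] norm_triangle_ineq2[of "D z - D x" "blinfun_apply D2 (z - x)"]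
      norm_blinfun[of D2 "z - x"]
    unfolding C_def by (simp add: algebra_simps)
  have "norm (g (x + h) - g x - blinfun_apply D1 h) \<le> C * (norm h)\<^sup>2" if h: "norm h < min d1 d2" for h
  proof -
    let ?k = "\<lambda>z. g z - blinfun_apply D1 z"
    have "norm (?k (x + h) - ?k x) \<le> (C * norm h) * norm (x + h - x)"
    proof (rule differentiable_bound[of "cball x (norm h)" _ "\<lambda>z. blinfun_apply (D z - D1)"])
      fix z assume "z \<in> cball x (norm h)"
      then have z: "norm (z - x) \<le> norm h" by (simp add: dist_norm norm_minus_commute)
      then show "(?k has_derivative blinfun_apply (D z - D1)) (at z within cball x (norm h))"
        using h by (auto intro!: derivative_eq_intros has_derivative_at_withinI[OF g']
            simp: dist_norm blinfun.diff_left)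
      have "norm (D z - D1) \<le> C * norm (z - x)"
        using lip[of z] z h by (simp add: Dx)
      also have "\<dots> \<le> C * norm h" using z by (intro mult_left_mono) (auto simp: C_def)
      finally show "onorm (blinfun_apply (D z - D1)) \<le> C * norm h"
        by (simp add: norm_blinfun.rep_eq)
    qed (auto simp: dist_norm)
    then show ?thesis by (simp add: blinfun.add_right power2_eq_square algebra_simps)
  qed
  with d1 d2 that[of "min d1 d2" C] show thesis by auto
qed

text \<open>An active function agrees with the maximum at \<open>x\<close> and lies below it
  elsewhere, so its own quadratic lower bound is inherited by the maximum, with constants uniform
  over the finitely many indices.\<close>

lemma twice_differentiable_active_lower_bound:
  fixes f :: "nat \<Rightarrow> 'a::real_normed_vector \<Rightarrow> ereal"
  assumes f: "\<And>k. k \<in> {1..m} \<Longrightarrow> twice_differentiable_ereal_at (f k) x"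
    and D: "\<And>k. k \<in> {1..m} \<Longrightarrow> ((\<lambda>z. real_of_ereal (f k z)) has_derivative D k) (at x)"
  shows "\<exists>C\<ge>0. \<exists>\<delta>>0. \<forall>k\<in>active_indices m f x. \<forall>h. norm h < \<delta> \<longrightarrow>
    max_fun m f x + ereal (D k h - C * (norm h)\<^sup>2) \<le> max_fun m f (x + h)"
proof -
  have "\<exists>C. \<forall>\<^sub>F h in nhds 0. f k x + ereal (D k h - C * (norm h)\<^sup>2) \<le> f k (x + h)"
    if k: "k \<in> {1..m}" for k
  proof -
    obtain D1 D2 where fin: "\<forall>\<^sub>F z in nhds x. \<bar>f k z\<bar> \<noteq> \<infinity>"
      and g: "has_second_derivative_at (\<lambda>z. real_of_ereal (f k z)) D1 D2 x"
      using f[OF k] unfolding twice_differentiable_ereal_at_def by auto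
    have D1: "blinfun_apply D1 = D k"
      by (rule has_derivative_unique[OF has_second_derivative_atD[OF g] D[OF k]])
    obtain C \<delta> where "0 < \<delta>" and C: "\<And>h. norm h < \<delta> \<Longrightarrow>
        norm (real_of_ereal (f k (x + h)) - real_of_ereal (f k x) - D k h) \<le> C * (norm h)\<^sup>2"
      using second_derivative_quadratic_bound[OF g, unfolded D1] by blast
    then have "\<forall>\<^sub>F h in nhds 0.
        norm (real_of_ereal (f k (x + h)) - real_of_ereal (f k x) - D k h) \<le> C * (norm h)\<^sup>2"
      unfolding eventually_nhds_metric dist_norm by (intro exI[of _ \<delta>]) auto
    moreover have "filterlim (\<lambda>h. x + h) (nhds x) (nhds 0)"
      by (auto intro!: tendsto_eq_intros filterlim_ident)
    from filterlim_iff[THEN iffD1, OF this, rule_format, OF fin]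
    have "\<forall>\<^sub>F h in nhds 0. \<bar>f k (x + h)\<bar> \<noteq> \<infinity>" .
    ultimately have "\<forall>\<^sub>F h in nhds 0. f k x + ereal (D k h - C * (norm h)\<^sup>2) \<le> f k (x + h)"
    proof eventually_elim
      case (elim h)
      with eventually_nhds_x_imp_x[OF fin] show ?case
        by (cases "f k x"; cases "f k (x + h)") auto
    qed
    then show ?thesis ..
  qed
  then obtain C where C: "\<And>k. k \<in> {1..m} \<Longrightarrow>
      \<forall>\<^sub>F h in nhds 0. f k x + ereal (D k h - C k * (norm h)\<^sup>2) \<le> f k (x + h)"
    by metis
  \<comment> \<open>A single constant for all indices; the absolute values make the sum dominate
    each \<open>C k\<close> and keep it nonnegative.\<close>
  define B where "B = (\<Sum>k\<in>{1..m}. \<bar>C k\<bar>)"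
  have B: "C k \<le> B" if "k \<in> {1..m}" for k
    using member_le_sum[of k "{1..m}" "\<lambda>k. \<bar>C k\<bar>"] that unfolding B_def by auto
  have "\<forall>\<^sub>F h in nhds 0. \<forall>k\<in>{1..m}. f k x + ereal (D k h - C k * (norm h)\<^sup>2) \<le> f k (x + h)"
    using C by (intro eventually_ball_finite) auto
  then obtain \<delta> where \<delta>: "0 < \<delta>" and low: "\<And>h k. norm h < \<delta> \<Longrightarrow> k \<in> {1..m} \<Longrightarrow>
      f k x + ereal (D k h - C k * (norm h)\<^sup>2) \<le> f k (x + h)"
    unfolding eventually_nhds_metric dist_norm by auto
  show ?thesis
  proof (rule exI[of _ B], rule conjI, goal_cases)
    case 1
    show "0 \<le> B" unfolding B_def by (intro sum_nonneg) auto
  next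
    case 2
    show ?case
    proof (rule exI[of _ \<delta>], intro conjI \<delta> ballI allI impI)
      fix k and h :: 'a assume k: "k \<in> active_indices m f x" and h: "norm h < \<delta>"
      then have k': "k \<in> {1..m}" and fk: "f k x = max_fun m f x" by (auto simp: active_indices_def)
      have "max_fun m f x + ereal (D k h - B * (norm h)\<^sup>2) \<le> f k x + ereal (D k h - C k * (norm h)\<^sup>2)"
        unfolding fk using B[OF k'] by (intro add_left_mono) (simp add: mult_right_mono)
      also have "\<dots> \<le> f k (x + h)" by (rule low[OF h k'])
      also have "\<dots> \<le> max_fun m f (x + h)"
        unfolding max_fun_def by (intro Max_ge) (use k' in auto)
      finally show "max_fun m f x + ereal (D k h - B * (norm h)\<^sup>2) \<le> max_fun m f (x + h)" .
    qed
  qed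
qed

text \<open>No continuity of \<open>w\<close> is assumed, so compactness of the sphere cannot give
  the bound. Instead the expansion is read off on one small sphere of radius \<open>t\<close>, where
  \<open>q\<close> and \<open>p\<close> are bounded, and homogeneity carries the bound to the unit
  sphere.\<close>

lemma homogeneous_expansion_bounded_on_sphere:
  fixes p q :: "'a::real_normed_vector \<Rightarrow> real"
  assumes hom: "\<And>t h. 0 < t \<Longrightarrow> w (t *\<^sub>R h) = t\<^sup>2 * w h"
    and q: "isCont q 0"
    and p: "\<And>h. \<bar>p h\<bar> \<le> M * norm h + N * (norm h)\<^sup>2"
    and \<delta>: "0 < \<delta>"
    and near: "\<And>h. h \<noteq> 0 \<Longrightarrow> norm h < \<delta> \<Longrightarrow> \<bar>q h - (p h + w h / 2)\<bar> \<le> (norm h)\<^sup>2"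
  shows "\<exists>B. \<forall>u. norm u = 1 \<longrightarrow> - B \<le> w u"
proof -
  obtain d where d: "0 < d" and qd: "\<And>h. norm h < d \<Longrightarrow> \<bar>q h - q 0\<bar> < 1"
    using q[unfolded continuous_at_eps_delta, rule_format, of 1] by (auto simp: dist_norm)
  define t where "t = min d \<delta> / 2"
  have t: "0 < t" "t < d" "t < \<delta>" using d \<delta> by (auto simp: t_def)
  \<comment> \<open>The summands bound \<open>q\<close>, \<open>p\<close> and the remainder on the
    sphere of radius \<open>t\<close>; the factor 2 undoes the half in front of
    \<open>w\<close>.\<close>
  define R where "R = 2 * (\<bar>q 0\<bar> + 1 + (M * t + N * t\<^sup>2) + t\<^sup>2)"
  have "- (R / t\<^sup>2) \<le> w u" if u: "norm u = 1" for u
  proof -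
    let ?h = "t *\<^sub>R u"
    have h: "norm ?h = t" and h0: "?h \<noteq> 0" using u t by auto
    have "\<bar>p ?h\<bar> \<le> M * t + N * t\<^sup>2" using p[of ?h] h by simp
    moreover have "\<bar>q ?h - q 0\<bar> < 1" using qd h t by simp
    moreover have "\<bar>q ?h - (p ?h + t\<^sup>2 * w u / 2)\<bar> \<le> t\<^sup>2"
      using near[OF h0] h t hom[OF t(1), of u] by simp
    ultimately have "- R \<le> t\<^sup>2 * w u"
      unfolding R_def by argo
    then show ?thesis
      using t by (simp add: field_simps)
  qed
  then show ?thesis by blast
qed

text \<open>This yields the right-hand saddle inequality, since \<open>zero\<close> makes
  \<open>max_fun m f x\<close> the value of the augmented Lagrangian at \<open>x\<close>. The KKT
  condition and the alternance enter only through \<open>kkt\<close> and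
  \<open>critical\<close>.\<close>

lemma second_order_expansion_local_minimum:
  fixes A :: "(real ^ 'd) set" and G :: "real ^ 'd \<Rightarrow> 'y::real_normed_vector"
  assumes "convex A" and x: "x \<in> A" and m: "1 \<le> m"
    and f: "\<And>k. k \<in> {1..m} \<Longrightarrow> twice_differentiable_ereal_at (f k) x"
    and D: "\<And>k. k \<in> {1..m} \<Longrightarrow> ((\<lambda>z. real_of_ereal (f k z)) has_derivative D k) (at x)"
    and expansion: "second_order_expansion A K G DG D2G \<Phi> x \<nu> \<mu>"
    and mono: "\<And>y. mono_on {0<..} (\<Phi> y \<nu>)"
    and zero: "\<And>c. 0 < c \<Longrightarrow> \<Phi> (G x) \<nu> c = 0"
    and cont: "isCont (\<lambda>h. real_of_ereal (\<Phi> (G (x + h)) \<nu> 1)) 0"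
    and kkt: "\<And>h. h \<in> contingent_cone A x \<Longrightarrow>
      \<exists>k\<in>active_indices m f x. 0 \<le> D k h + blinfun_apply \<mu> (blinfun_apply DG h)"
    and critical: "\<And>h. h \<in> critical_cone A K G DG x \<mu> \<Longrightarrow> h \<noteq> 0 \<Longrightarrow>
      \<exists>k\<in>active_indices m f x. 0 < D k h"
  shows "\<exists>c\<^sub>0>0. \<exists>U. open U \<and> x \<in> U \<and>
    (\<forall>c\<ge>c\<^sub>0. \<forall>z\<in>U \<inter> A. max_fun m f x \<le> max_fun m f z + \<Phi> (G z) \<nu> c)"
proof (rule ccontr)
  assume contra: "\<not> ?thesis"
  let ?F = "max_fun m f"
  define T where "T h = blinfun_apply \<mu> (blinfun_apply DG h)" for h
  define Q where "Q h = blinfun_apply \<mu> (blinfun_apply (blinfun_apply D2G h) h)" for h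
  obtain k where k: "k \<in> {1..m}" and Fk: "f k x = ?F x"
    using active_indices_nonempty[OF m, of f x] unfolding active_indices_def by auto
  have "\<bar>f k x\<bar> \<noteq> \<infinity>"
    by (rule eventually_nhds_x_imp_x)
      (use f[OF k] in \<open>simp add: twice_differentiable_ereal_at_def\<close>)
  then have "\<bar>?F x\<bar> \<noteq> \<infinity>" by (simp only: Fk not_False_eq_True)
  then obtain a where a: "?F x = ereal a" by (cases "?F x") auto
  obtain \<omega> :: "real \<Rightarrow> real ^ 'd \<Rightarrow> real" where
    hom_exp: "\<forall>c>0. (\<forall>t>0. \<forall>h. \<omega> c (t *\<^sub>R h) = t\<^sup>2 * \<omega> c h) \<and>
        (\<exists>r. (\<forall>\<^sub>F h in nhds 0. \<Phi> (G (x + h)) \<nu> c - \<Phi> (G x) \<nu> c =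
          ereal (blinfun_apply \<mu> (blinfun_apply DG h)
            + blinfun_apply \<mu> (blinfun_apply (blinfun_apply D2G h) h) / 2
            + \<omega> c h / 2 + r h)) \<and> ((\<lambda>h. r h / (norm h)\<^sup>2) \<longlongrightarrow> 0) (at 0))"
    and lsup': "\<forall>h\<^sub>0\<in>contingent_cone A x. \<forall>(h :: nat \<Rightarrow> real ^ 'd) (c :: nat \<Rightarrow> real).
        h \<longlonglongrightarrow> h\<^sub>0 \<longrightarrow> filterlim c at_top sequentially \<longrightarrow>
        \<bar>limsup (\<lambda>n. ereal (\<omega> (c n) (h n)))\<bar> \<noteq> \<infinity> \<longrightarrow>
          h\<^sub>0 \<in> critical_cone A K G DG x \<mu> \<and>
          limsup (\<lambda>n. ereal (\<omega> (c n) (h n))) \<ge>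
            - support_fun \<mu> (second_order_tangent_set K (G x) (blinfun_apply DG h\<^sub>0))"
    using expansion unfolding second_order_expansion_def by (elim exE conjE) (rule that)
  have hom: "\<omega> c (t *\<^sub>R h) = t\<^sup>2 * \<omega> c h" if "0 < c" "0 < t" for c t h
    using hom_exp that by blast
  have exp: "\<exists>r. (\<forall>\<^sub>F h in nhds 0. \<Phi> (G (x + h)) \<nu> c - \<Phi> (G x) \<nu> c =
      ereal (T h + Q h / 2 + \<omega> c h / 2 + r h)) \<and> ((\<lambda>h. r h / (norm h)\<^sup>2) \<longlongrightarrow> 0) (at 0)"
    if "0 < c" for c
    using hom_exp[rule_format, OF that] unfolding T_def Q_def by (rule conjunct2)
  have lsup: "h\<^sub>0 \<in> critical_cone A K G DG x \<mu>"
    if "h\<^sub>0 \<in> contingent_cone A x" "h \<longlonglongrightarrow> h\<^sub>0" "filterlim c at_top sequentially"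
      "\<bar>limsup (\<lambda>n. ereal (\<omega> (c n) (h n)))\<bar> \<noteq> \<infinity>" for h\<^sub>0 and h :: "nat \<Rightarrow> real ^ 'd" and c
    using lsup'[rule_format, OF that] by (rule conjunct1)
  \<comment> \<open>The little-o remainder is replaced by the cruder bound
    \<open>(norm h)\<^sup>2\<close>, valid on a radius depending on \<open>c\<close>. As \<Phi>
    vanishes at \<open>x\<close>, the expansion describes \<Phi> itself and shows that it is finite
    there.\<close>
  have near: "\<exists>\<delta>>0. \<forall>h. h \<noteq> 0 \<longrightarrow> norm h < \<delta> \<longrightarrow> (\<exists>\<phi>. \<Phi> (G (x + h)) \<nu> c = ereal \<phi> \<and>
      \<bar>\<phi> - (T h + Q h / 2 + \<omega> c h / 2)\<bar> \<le> (norm h)\<^sup>2)" if c: "0 < c" for c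
  proof -
    obtain r where r: "\<forall>\<^sub>F h in nhds 0. \<Phi> (G (x + h)) \<nu> c - \<Phi> (G x) \<nu> c =
        ereal (T h + Q h / 2 + \<omega> c h / 2 + r h)" and r0: "((\<lambda>h. r h / (norm h)\<^sup>2) \<longlongrightarrow> 0) (at 0)"
      using exp[OF c] by auto
    have "\<forall>\<^sub>F h in at 0. \<bar>r h / (norm h)\<^sup>2\<bar> < 1"
      using tendstoD[OF r0, of 1] by (simp add: dist_norm)
    moreover have "\<forall>\<^sub>F h in at 0. \<Phi> (G (x + h)) \<nu> c - \<Phi> (G x) \<nu> c =
        ereal (T h + Q h / 2 + \<omega> c h / 2 + r h)"
      using r by (simp add: eventually_at_filter eventually_mono)
    moreover have "\<forall>\<^sub>F h :: real ^ 'd in at 0. h \<noteq> 0" by (simp add: eventually_at_filter)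
    ultimately have "\<forall>\<^sub>F h in at 0. \<exists>\<phi>. \<Phi> (G (x + h)) \<nu> c = ereal \<phi> \<and>
        \<bar>\<phi> - (T h + Q h / 2 + \<omega> c h / 2)\<bar> \<le> (norm h)\<^sup>2"
    proof eventually_elim
      case (elim h)
      then have "\<bar>r h\<bar> \<le> (norm h)\<^sup>2" by (simp add: field_simps)
      then show ?case using elim(2) by (simp add: zero[OF c])
    qed
    then show ?thesis unfolding eventually_at dist_norm by auto
  qed
  obtain C \<delta>f where \<delta>f: "0 < \<delta>f" and C: "0 \<le> C"
    and low: "\<And>k h. k \<in> active_indices m f x \<Longrightarrow> norm h < \<delta>f \<Longrightarrow>
      ?F x + ereal (D k h - C * (norm h)\<^sup>2) \<le> ?F (x + h)"
  proof -
    have "\<exists>C\<ge>0. \<exists>\<delta>>0. \<forall>k\<in>active_indices m f x. \<forall>h. norm h < \<delta> \<longrightarrow>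
        ?F x + ereal (D k h - C * (norm h)\<^sup>2) \<le> ?F (x + h)"
      by (rule twice_differentiable_active_lower_bound[OF f D])
    then show thesis using that by blast
  qed
  obtain \<delta>1 where \<delta>1: "0 < \<delta>1" and near1: "\<And>h. h \<noteq> 0 \<Longrightarrow> norm h < \<delta>1 \<Longrightarrow>
      \<exists>\<phi>. \<Phi> (G (x + h)) \<nu> 1 = ereal \<phi> \<and> \<bar>\<phi> - (T h + Q h / 2 + \<omega> 1 h / 2)\<bar> \<le> (norm h)\<^sup>2"
    using near[of 1] by auto
  define N where "N = norm \<mu> * norm D2G"
  have Qb: "\<bar>Q h\<bar> \<le> N * (norm h)\<^sup>2" for h
  proof -
    have "\<bar>Q h\<bar> \<le> norm \<mu> * norm (blinfun_apply (blinfun_apply D2G h) h)"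
      using norm_blinfun[of \<mu>] by (simp add: Q_def)
    also have "\<dots> \<le> norm \<mu> * (norm D2G * norm h * norm h)"
      by (intro mult_left_mono order_trans[OF norm_blinfun] mult_right_mono norm_blinfun) auto
    finally show ?thesis by (simp add: N_def power2_eq_square mult.assoc)
  qed
  have N: "0 \<le> N" by (simp add: N_def)
  have "\<exists>B. \<forall>u. norm u = 1 \<longrightarrow> - B \<le> \<omega> 1 u"
  proof (rule homogeneous_expansion_bounded_on_sphere[OF _ cont _ \<delta>1])
    show "\<omega> 1 (t *\<^sub>R h) = t\<^sup>2 * \<omega> 1 h" if "0 < t" for t h using hom that by simp
    show "\<bar>T h + Q h / 2\<bar> \<le> norm (\<mu> o\<^sub>L DG) * norm h + N * (norm h)\<^sup>2" for h
      using norm_blinfun[of "\<mu> o\<^sub>L DG" h] Qb[of h] by (simp add: T_def)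
    show "\<bar>real_of_ereal (\<Phi> (G (x + h)) \<nu> 1) - (T h + Q h / 2 + \<omega> 1 h / 2)\<bar> \<le> (norm h)\<^sup>2"
      if "h \<noteq> 0" "norm h < \<delta>1" for h
      using near1[OF that] by auto
  qed
  then obtain B where B: "\<And>u. norm u = 1 \<Longrightarrow> - B \<le> \<omega> 1 u" by blast
  \<comment> \<open>Twice the sum of the three errors, each relative to
    \<open>(norm h)\<^sup>2\<close>: \<open>C\<close> from the objective, \<open>N / 2\<close> from
    the second derivative of \<open>G\<close>, and 1 from the remainder.\<close>
  define R where "R = 2 * C + N + 2"
  have step: "\<exists>h. h \<noteq> 0 \<and> x + h \<in> A \<and> norm h < 1 / real (Suc n) \<and>
      (\<forall>k\<in>active_indices m f x. D k h + T h \<le> (R + (B + 4) / 2) * (norm h)\<^sup>2) \<and>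
      - (B + 4) \<le> \<omega> (real (Suc n)) ((1 / norm h) *\<^sub>R h) \<and>
      \<omega> (real (Suc n)) ((1 / norm h) *\<^sub>R h) \<le> R" for n
  proof -
    let ?c = "real (Suc n)"
    obtain \<delta> where \<delta>: "0 < \<delta>" and nearn: "\<And>h. h \<noteq> 0 \<Longrightarrow> norm h < \<delta> \<Longrightarrow>
        \<exists>\<phi>. \<Phi> (G (x + h)) \<nu> ?c = ereal \<phi> \<and> \<bar>\<phi> - (T h + Q h / 2 + \<omega> ?c h / 2)\<bar> \<le> (norm h)\<^sup>2"
      using near[of ?c] by auto
    define \<epsilon> where "\<epsilon> = min (min \<delta> \<delta>1) (min \<delta>f (1 / ?c))"
    have \<epsilon>: "0 < \<epsilon>" using \<delta> \<delta>1 \<delta>f by (simp add: \<epsilon>_def)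
    obtain c z where c: "?c \<le> c" and z: "z \<in> ball x \<epsilon>" "z \<in> A"
      and "\<not> ?F x \<le> ?F z + \<Phi> (G z) \<nu> c"
    proof -
      have "\<not> (open (ball x \<epsilon>) \<and> x \<in> ball x \<epsilon> \<and>
        (\<forall>c\<ge>?c. \<forall>z\<in>ball x \<epsilon> \<inter> A. ?F x \<le> ?F z + \<Phi> (G z) \<nu> c))"
        using contra by (metis of_nat_0_less_iff zero_less_Suc)
      then show thesis using \<epsilon> that by auto
    qed
    \<comment> \<open>The violating parameter \<open>c\<close> may exceed \<open>?c\<close>; by
      monotonicity the violation persists at \<open>?c\<close>, so the parameters along the sequence
      are exactly n + 1.\<close>
    moreover have "\<Phi> (G z) \<nu> ?c \<le> \<Phi> (G z) \<nu> c"
      by (rule mono_onD[OF mono]) (use c in auto)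
    ultimately have less: "?F z + \<Phi> (G z) \<nu> ?c < ?F x"
      by (meson add_left_mono not_le order_trans)
    define h where "h = z - x"
    have z_eq: "z = x + h" by (simp add: h_def)
    have h0: "h \<noteq> 0" using less zero[of ?c] by (auto simp: h_def)
    have hn: "norm h < \<delta>" "norm h < \<delta>1" "norm h < \<delta>f" "norm h < 1 / ?c"
      using z by (auto simp: h_def \<epsilon>_def dist_norm norm_minus_commute)
    obtain p where p: "\<Phi> (G z) \<nu> ?c = ereal p"
      and pb: "\<bar>p - (T h + Q h / 2 + \<omega> ?c h / 2)\<bar> \<le> (norm h)\<^sup>2"
      using nearn[OF h0 hn(1)] unfolding z_eq by auto
    obtain p1 where p1: "\<Phi> (G z) \<nu> 1 = ereal p1"
      and p1b: "\<bar>p1 - (T h + Q h / 2 + \<omega> 1 h / 2)\<bar> \<le> (norm h)\<^sup>2"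
      using near1[OF h0 hn(2)] unfolding z_eq by auto
    have "\<Phi> (G z) \<nu> 1 \<le> \<Phi> (G z) \<nu> ?c"
      by (rule mono_onD[OF mono]) auto
    then have pp: "p1 \<le> p" unfolding p p1 by simp
    have Dk: "D k h - C * (norm h)\<^sup>2 + p < 0" if k: "k \<in> active_indices m f x" for k
    proof -
      have "ereal (a + (D k h - C * (norm h)\<^sup>2)) + ereal p \<le> ?F z + ereal p"
        using low[OF k hn(3)] unfolding a z_eq by (intro add_right_mono) simp
      also have "\<dots> < ereal a" using less unfolding p a .
      finally show ?thesis by simp
    qed
    let ?s = "norm h" and ?u = "(1 / norm h) *\<^sub>R h"
    have s: "0 < ?s" using h0 by simp
    have w: "\<omega> c h = ?s\<^sup>2 * \<omega> c ?u" if "0 < c" for c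
      using hom[OF that s, of ?u] s by simp
    have "norm ?u = 1" using s by simp
    then have "?s\<^sup>2 * - B \<le> ?s\<^sup>2 * \<omega> 1 ?u" using B by (intro mult_left_mono) auto
    \<comment> \<open>Subtracting the expansions for \<open>1\<close> and \<open>?c\<close> cancels
      \<open>T\<close> and \<open>Q\<close>. The two remainders cost \<open>2 * ?s\<^sup>2\<close>,
      which the factor 1/2 in front of \<omega> doubles to the 4.\<close>
    then have "- (B + 4) * ?s\<^sup>2 \<le> ?s\<^sup>2 * \<omega> ?c ?u"
      using pp pb p1b w[of 1] w[of ?c] by (simp add: algebra_simps abs_le_iff)
    then have lo: "- (B + 4) \<le> \<omega> ?c ?u" and lo': "- (B + 4) * ?s\<^sup>2 \<le> \<omega> ?c h"
      using s w[of ?c] by (auto simp: mult.commute[of "?s\<^sup>2"])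
    have "h \<in> contingent_cone A x"
      unfolding h_def by (rule convex_diff_in_contingent_cone) (use assms z in auto)
    then obtain k where k: "k \<in> active_indices m f x" and kh: "0 \<le> D k h + T h"
      using kkt unfolding T_def by blast
    \<comment> \<open>Only one active index, depending on \<open>h\<close>, satisfies the KKT
      inequality for certain, and one suffices here; the bound derived below from \<open>lo'\<close>
      is needed for every active index, because the index provided by \<open>critical\<close> is
      fixed later.\<close>
    have "\<omega> ?c h \<le> R * ?s\<^sup>2"
      using Dk[OF k] kh pb Qb[of h] unfolding R_def by (simp add: algebra_simps abs_le_iff)
    then have hi: "\<omega> ?c ?u \<le> R"
      using s w[of ?c] by (simp add: mult.commute[of "?s\<^sup>2"])
    have "D k h + T h \<le> (R + (B + 4) / 2) * ?s\<^sup>2" if "k \<in> active_indices m f x" for k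
    proof -
      have "0 \<le> C * ?s\<^sup>2" "0 \<le> N * ?s\<^sup>2" using C N by auto
      moreover have "(R + (B + 4) / 2) * ?s\<^sup>2 =
          2 * (C * ?s\<^sup>2) + N * ?s\<^sup>2 + 4 * ?s\<^sup>2 + (B * ?s\<^sup>2) / 2"
        unfolding R_def by (simp add: field_simps)
      moreover have "- (B * ?s\<^sup>2) - 4 * ?s\<^sup>2 \<le> \<omega> ?c h" using lo' by (simp add: algebra_simps)
      ultimately show ?thesis
        using Dk[OF that] pb Qb[of h] zero_le_power2[of ?s] unfolding abs_le_iff by linarith
    qed
    then show ?thesis using h0 hn z lo hi z_eq by auto
  qed
  then obtain h where h0: "\<And>n. h n \<noteq> 0" and hA: "\<And>n. x + h n \<in> A"
    and hn: "\<And>n. norm (h n) < 1 / real (Suc n)"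
    and up: "\<And>n k. k \<in> active_indices m f x \<Longrightarrow>
        D k (h n) + T (h n) \<le> (R + (B + 4) / 2) * (norm (h n))\<^sup>2"
    and wlo: "\<And>n. - (B + 4) \<le> \<omega> (real (Suc n)) ((1 / norm (h n)) *\<^sub>R h n)"
    and whi: "\<And>n. \<omega> (real (Suc n)) ((1 / norm (h n)) *\<^sub>R h n) \<le> R"
    by metis
  define u where "u n = (1 / norm (h n)) *\<^sub>R h n" for n
  have "\<And>n. u n \<in> sphere 0 1" using h0 by (simp add: u_def)
  then obtain hs \<rho> where hs: "hs \<in> sphere 0 1" and \<rho>: "strict_mono \<rho>" and lim: "(u \<circ> \<rho>) \<longlonglongrightarrow> hs"
    using compact_sphere[of "0 :: real ^ 'd" 1] unfolding compact_def by metis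
  have "(\<lambda>n. norm (h n)) \<longlonglongrightarrow> 0"
    by (rule tendsto_sandwich[OF _ _ tendsto_const LIMSEQ_inverse_real_of_nat])
      (use hn in \<open>auto simp: inverse_eq_divide intro!: always_eventually less_imp_le\<close>)
  from LIMSEQ_subseq_LIMSEQ[OF this \<rho>] have hlim: "(\<lambda>n. norm (h (\<rho> n))) \<longlonglongrightarrow> 0"
    by (simp add: comp_def)
  \<comment> \<open>The step lengths \<open>norm (h (\<rho> n))\<close> and the unit directions
    reproduce the points \<open>x + h (\<rho> n)\<close> of \<open>A\<close>, which makes
    \<open>hs\<close> tangent.\<close>
  have "x + norm (h (\<rho> n)) *\<^sub>R (u \<circ> \<rho>) n \<in> A" for n
    using hA h0 by (simp add: u_def)
  then have "hs \<in> contingent_cone A x"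
    unfolding contingent_cone_def using lim hlim h0
    by (auto intro!: exI[of _ "\<lambda>n. norm (h (\<rho> n))"] exI[of _ "u \<circ> \<rho>"])
  moreover have "filterlim (\<lambda>n. real (Suc (\<rho> n))) at_top sequentially"
    using filterlim_compose[OF filterlim_real_sequentially
      filterlim_compose[OF filterlim_Suc filterlim_subseq[OF \<rho>]]] .
  \<comment> \<open>The two-sided bounds on \<omega> make the upper limit finite, which is what the
    expansion requires to conclude that \<open>hs\<close> is critical.\<close>
  moreover have "\<bar>limsup (\<lambda>n. ereal (\<omega> (real (Suc (\<rho> n))) ((u \<circ> \<rho>) n)))\<bar> \<noteq> \<infinity>" (is "\<bar>?L\<bar> \<noteq> _")
  proof -
    have "ereal (- (B + 4)) \<le> liminf (\<lambda>n. ereal (\<omega> (real (Suc (\<rho> n))) ((u \<circ> \<rho>) n)))"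
      by (intro Liminf_bounded) (use wlo in \<open>simp add: u_def\<close>)
    also have "\<dots> \<le> ?L" by (rule Liminf_le_Limsup) simp
    finally have "ereal (- (B + 4)) \<le> ?L" .
    moreover have "?L \<le> ereal R"
      by (intro Limsup_bounded) (use whi in \<open>simp add: u_def\<close>)
    ultimately show ?thesis by (cases ?L) auto
  qed
  ultimately have crit: "hs \<in> critical_cone A K G DG x \<mu>"
    by (rule lsup[OF _ lim])
  then obtain k where k: "k \<in> active_indices m f x" and pos: "0 < D k hs"
    using critical hs by fastforce
  have T0: "T hs = 0" using crit by (simp add: critical_cone_def T_def)
  have "k \<in> {1..m}" using k by (simp add: active_indices_def)
  from has_derivative_bounded_linear[OF D[OF this]] have bl: "bounded_linear (D k)" .
  \<comment> \<open>The bound \<open>up\<close> is quadratic in \<open>h n\<close>, so dividing by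
    the norm leaves a right-hand side tending to 0. In the limit \<open>T\<close> vanishes by
    criticality, contradicting \<open>pos\<close>.\<close>
  have "D k (u n) + T (u n) \<le> (R + (B + 4) / 2) * norm (h n)" for n
  proof -
    have "D k (u n) + T (u n) = (D k (h n) + T (h n)) / norm (h n)"
      unfolding u_def T_def linear_scale[OF bounded_linear.linear[OF bl]]
      by (simp add: blinfun.scaleR_right add_divide_distrib)
    also have "\<dots> \<le> (R + (B + 4) / 2) * norm (h n)"
      using up[OF k, of n] h0[of n] by (simp add: divide_le_eq power2_eq_square mult.assoc)
    finally show ?thesis .
  qed
  moreover have "(\<lambda>n. D k ((u \<circ> \<rho>) n) + T ((u \<circ> \<rho>) n)) \<longlonglongrightarrow> D k hs + T hs"
    unfolding T_def by (intro tendsto_intros bounded_linear.tendsto[OF bl] lim)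
  moreover have "(\<lambda>n. (R + (B + 4) / 2) * norm (h (\<rho> n))) \<longlonglongrightarrow> (R + (B + 4) / 2) * 0"
    by (intro tendsto_intros hlim)
  ultimately have "D k hs + T hs \<le> 0"
    by (intro LIMSEQ_le[of "\<lambda>n. D k ((u \<circ> \<rho>) n) + T ((u \<circ> \<rho>) n)"]) auto
  with pos T0 show False by simp
qed

section \<open>KKT-pairs and what the alternance provides\<close>

lemma KKT_pair_iff:
  fixes f :: "nat \<Rightarrow> 'a::real_normed_vector \<Rightarrow> ereal" and G :: "'a \<Rightarrow> 'y::real_normed_vector"
  assumes m: "1 \<le> m" and fin: "\<And>k. k \<in> {1..m} \<Longrightarrow> \<forall>\<^sub>F z in nhds x. \<bar>f k z\<bar> \<noteq> \<infinity>"
    and D: "\<And>k. k \<in> {1..m} \<Longrightarrow> ((\<lambda>z. real_of_ereal (f k z)) has_derivative D k) (at x)"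
    and G: "(G has_derivative blinfun_apply DG) (at x)"
  shows "KKT_pair (max_fun m f) G A K x \<mu> \<longleftrightarrow>
    x \<in> A \<and> G x \<in> K \<and> \<mu> \<in> polar_cone K \<and> blinfun_apply \<mu> (G x) = 0 \<and>
    (\<forall>h\<in>contingent_cone A x. \<exists>k\<in>active_indices m f x.
       0 \<le> D k h + blinfun_apply \<mu> (blinfun_apply DG h))"
proof -
  let ?J = "active_indices m f x"
  have J: "finite ?J" "?J \<noteq> {}"
    using active_indices_nonempty[OF m] by (auto simp: active_indices_def)
  \<comment> \<open>The directional derivative is unique and equals the largest active derivative
    plus the multiplier term; a maximum reaches a threshold iff some member does.\<close>
  have "(\<exists>l. has_directional_derivative (\<lambda>z. lagrangian (max_fun m f) G z \<mu>) l x h \<and> 0 \<le> l) \<longleftrightarrow>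
      (\<exists>k\<in>?J. 0 \<le> D k h + blinfun_apply \<mu> (blinfun_apply DG h))" for h
  proof -
    let ?l = "Max ((\<lambda>k. D k h) ` ?J) + blinfun_apply \<mu> (blinfun_apply DG h)"
    have "has_directional_derivative (\<lambda>z. lagrangian (max_fun m f) G z \<mu>) (ereal ?l) x h"
      by (rule has_directional_derivative_lagrangian_max[OF m fin D G])
    moreover from this have "l = ereal ?l"
      if "has_directional_derivative (\<lambda>z. lagrangian (max_fun m f) G z \<mu>) l x h" for l
      using that unfolding has_directional_derivative_def
      by (intro tendsto_unique[OF trivial_limit_at_right_real])
    ultimately have "(\<exists>l. has_directional_derivative (\<lambda>z. lagrangian (max_fun m f) G z \<mu>) l x h \<and> 0 \<le> l)
        \<longleftrightarrow> 0 \<le> ereal ?l"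
      by blast
    also have "\<dots> \<longleftrightarrow> - blinfun_apply \<mu> (blinfun_apply DG h) \<le> Max ((\<lambda>k. D k h) ` ?J)"
      by (auto simp: zero_ereal_def)
    also have "\<dots> \<longleftrightarrow> (\<exists>k\<in>?J. - blinfun_apply \<mu> (blinfun_apply DG h) \<le> D k h)"
      using J by (subst Max_ge_iff) auto
    also have "\<dots> \<longleftrightarrow> (\<exists>k\<in>?J. 0 \<le> D k h + blinfun_apply \<mu> (blinfun_apply DG h))"
      by (intro bex_cong) auto
    finally show ?thesis .
  qed
  then show ?thesis unfolding KKT_pair_def by simp
qed

lemma gderiv_eq_inner:
  assumes "GDERIV g x :> v" and "(g has_derivative D) (at x)"
  shows "D h = v \<bullet> h"
  using has_derivative_unique[OF assms(2) assms(1)[unfolded gderiv_def]]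
  by (simp add: inner_commute)

text \<open>Otherwise every \<open>V i\<close> would pair nonpositively with \<open>h\<close>:
  gradients by the contrary assumption, dual vectors because \<open>DG h\<close> is tangent to
  \<open>K\<close>, normal vectors because \<open>h\<close> is tangent to \<open>A\<close>. The
  alternance then forces \<open>h = 0\<close>.\<close>

lemma complete_alternance_critical:
  fixes G :: "real ^ 'd \<Rightarrow> 'y::real_normed_vector"
  assumes alt: "complete_alternance m f G DG A K x"
    and D: "\<And>k. k \<in> {1..m} \<Longrightarrow> ((\<lambda>z. real_of_ereal (f k z)) has_derivative D k) (at x)"
    and h: "h \<in> critical_cone A K G DG x \<mu>" "h \<noteq> 0"
  shows "\<exists>k\<in>active_indices m f x. 0 < D k h"
proof (rule ccontr)
  assume contra: "\<not> ?thesis"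
  obtain k0 i0 and V :: "nat \<Rightarrow> real ^ 'd" where
    V1: "\<And>i. i \<in> {1..k0} \<Longrightarrow> \<exists>k\<in>active_indices m f x.
        GDERIV (\<lambda>z. real_of_ereal (f k z)) x :> V i"
    and V2: "\<And>i. i \<in> {k0 + 1..i0} \<Longrightarrow>
        V i \<in> dual_adjoint DG ` {ys \<in> polar_cone K. blinfun_apply ys (G x) = 0}"
    and V3: "\<And>i. i \<in> {i0 + 1..CARD('d) + 1} \<Longrightarrow> V i \<in> normal_cone A x"
    and nz: "\<And>s. s \<in> {1..CARD('d) + 1} \<Longrightarrow> alternance_det V s \<noteq> 0"
    and sg: "\<And>s. s \<in> {1..CARD('d)} \<Longrightarrow>
        sgn (alternance_det V s) = - sgn (alternance_det V (s + 1))"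
    using alt unfolding complete_alternance_def by blast
  obtain a where a: "\<And>i. i \<in> {1..CARD('d) + 1} \<Longrightarrow> 0 < a i"
    and dep: "(\<Sum>i\<in>{1..CARD('d) + 1}. a i *\<^sub>R V i) = 0"
    using alternance_positive_dependency[of V] nz sg by blast
  have "V i \<bullet> h \<le> 0" if "i \<in> {1..CARD('d) + 1}" for i
  proof -
    consider "i \<in> {1..k0}" | "i \<in> {k0 + 1..i0}" | "i \<in> {i0 + 1..CARD('d) + 1}"
      using \<open>i \<in> {1..CARD('d) + 1}\<close> by fastforce
    then show ?thesis
    proof cases
      case 1
      then obtain k where k: "k \<in> active_indices m f x"
        and gd: "GDERIV (\<lambda>z. real_of_ereal (f k z)) x :> V i" using V1 by blast
      have "D k h = V i \<bullet> h"
        by (rule gderiv_eq_inner[OF gd D]) (use k in \<open>simp add: active_indices_def\<close>)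
      then show ?thesis using contra k by fastforce
    next
      case 2
      then obtain ys where ys: "ys \<in> polar_cone K" "blinfun_apply ys (G x) = 0"
        and Vi: "V i = dual_adjoint DG ys" using V2 by blast
      show ?thesis
        unfolding Vi dual_adjoint_inner
        by (rule polar_cone_contingent_nonpos[OF ys])
          (use h in \<open>simp add: critical_cone_def\<close>)
    next
      case 3
      then show ?thesis using V3 h by (auto simp: normal_cone_def critical_cone_def)
    qed
  qed
  with alternance_nonpos_imp_zero[OF nz a dep] have "h = 0" by blast
  with h show False by simp
qed

text \<open>Dividing the positive dependency by the total weight of the gradients makes their
  weights a convex combination; the weighted functionals behind the dual vectors sum to the
  multiplier.\<close>

lemma complete_alternance_multiplier:
  fixes G :: "real ^ 'd \<Rightarrow> 'y::real_normed_vector"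
  assumes alt: "complete_alternance m f G DG A K x"
    and D: "\<And>k. k \<in> {1..m} \<Longrightarrow> ((\<lambda>z. real_of_ereal (f k z)) has_derivative D k) (at x)"
  obtains \<mu> where "\<mu> \<in> polar_cone K" and "blinfun_apply \<mu> (G x) = 0"
    and "\<And>h. h \<in> contingent_cone A x \<Longrightarrow>
      \<exists>k\<in>active_indices m f x. 0 \<le> D k h + blinfun_apply \<mu> (blinfun_apply DG h)"
proof -
  obtain k0 i0 and V :: "nat \<Rightarrow> real ^ 'd" where k0: "k0 \<in> {1..CARD('d) + 1}"
    and i0: "i0 \<in> {k0..CARD('d) + 1}"
    and V1: "\<And>i. i \<in> {1..k0} \<Longrightarrow> \<exists>k\<in>active_indices m f x.
        GDERIV (\<lambda>z. real_of_ereal (f k z)) x :> V i"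
    and V2: "\<And>i. i \<in> {k0 + 1..i0} \<Longrightarrow>
        V i \<in> dual_adjoint DG ` {ys \<in> polar_cone K. blinfun_apply ys (G x) = 0}"
    and V3: "\<And>i. i \<in> {i0 + 1..CARD('d) + 1} \<Longrightarrow> V i \<in> normal_cone A x"
    and nz: "\<And>s. s \<in> {1..CARD('d) + 1} \<Longrightarrow> alternance_det V s \<noteq> 0"
    and sg: "\<And>s. s \<in> {1..CARD('d)} \<Longrightarrow>
        sgn (alternance_det V s) = - sgn (alternance_det V (s + 1))"
    using alt unfolding complete_alternance_def by blast
  obtain a where a: "\<And>i. i \<in> {1..CARD('d) + 1} \<Longrightarrow> 0 < a i"
    and dep: "(\<Sum>i\<in>{1..CARD('d) + 1}. a i *\<^sub>R V i) = 0"
    using alternance_positive_dependency[of V] nz sg by blast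
  have "\<exists>ys. ys \<in> polar_cone K \<and> blinfun_apply ys (G x) = 0 \<and> V i = dual_adjoint DG ys"
    if "i \<in> {k0 + 1..i0}" for i
    using V2[OF that] by blast
  then obtain y where y: "\<And>i. i \<in> {k0 + 1..i0} \<Longrightarrow> y i \<in> polar_cone K"
    and y0: "\<And>i. i \<in> {k0 + 1..i0} \<Longrightarrow> blinfun_apply (y i) (G x) = 0"
    and Vy: "\<And>i. i \<in> {k0 + 1..i0} \<Longrightarrow> V i = dual_adjoint DG (y i)"
    by metis
  \<comment> \<open>The normalisation is possible because \<open>k0\<close> is at least 1, so at
    least one gradient occurs.\<close>
  define S where "S = (\<Sum>i\<in>{1..k0}. a i)"
  have S: "0 < S" unfolding S_def by (rule sum_pos) (use a k0 in auto)
  define \<mu> where "\<mu> = (1 / S) *\<^sub>R (\<Sum>i\<in>{k0 + 1..i0}. a i *\<^sub>R y i)"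
  have \<mu>: "blinfun_apply \<mu> v = (1 / S) * (\<Sum>i\<in>{k0 + 1..i0}. a i * blinfun_apply (y i) v)" for v
    by (simp add: \<mu>_def blinfun.scaleR_left blinfun.sum_left)
  show thesis
  proof (rule that)
    show "\<mu> \<in> polar_cone K"
    proof -
      have "blinfun_apply \<mu> v \<le> 0" if "v \<in> K" for v
      proof -
        have "a i * blinfun_apply (y i) v \<le> 0" if i: "i \<in> {k0 + 1..i0}" for i
        proof -
          have "0 < a i" using a i i0 by auto
          then show ?thesis using y[OF i] \<open>v \<in> K\<close>
            by (simp add: polar_cone_def mult_nonneg_nonpos)
        qed
        then have "(\<Sum>i\<in>{k0 + 1..i0}. a i * blinfun_apply (y i) v) \<le> 0" by (rule sum_nonpos)
        then show ?thesis unfolding \<mu> using S by (intro mult_nonneg_nonpos) auto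
      qed
      then show ?thesis by (simp add: polar_cone_def)
    qed
    show "blinfun_apply \<mu> (G x) = 0" unfolding \<mu> using y0 by simp
  next
    fix h assume h: "h \<in> contingent_cone A x"
    let ?\<mu> = "blinfun_apply \<mu> (blinfun_apply DG h)"
    show "\<exists>k\<in>active_indices m f x. 0 \<le> D k h + ?\<mu>"
    proof (rule ccontr)
      assume contra: "\<not> ?thesis"
      have neg: "V i \<bullet> h + ?\<mu> < 0" if i: "i \<in> {1..k0}" for i
      proof -
        obtain k where k: "k \<in> active_indices m f x"
          and gd: "GDERIV (\<lambda>z. real_of_ereal (f k z)) x :> V i" using V1[OF i] by blast
        have "D k h = V i \<bullet> h"
          by (rule gderiv_eq_inner[OF gd D]) (use k in \<open>simp add: active_indices_def\<close>)
        then show ?thesis using contra k by fastforce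
      qed
      let ?w = "\<lambda>i. a i * (V i \<bullet> h)"
      \<comment> \<open>Summing with the weights \<open>a i\<close> turns the multiplier term into
        \<open>S * ?\<mu>\<close>, exactly the contribution of the dual vectors to the dependency.
        The normal vectors add at most 0, so the total would be negative instead of zero.\<close>
      have "(\<Sum>i\<in>{1..k0}. a i * (V i \<bullet> h + ?\<mu>)) < (\<Sum>i\<in>{1..k0}. 0)"
      proof (rule sum_strict_mono)
        fix i assume i: "i \<in> {1..k0}"
        then have "0 < a i" using a k0 by auto
        then show "a i * (V i \<bullet> h + ?\<mu>) < 0" using neg[OF i] by (rule mult_pos_neg)
      qed (use k0 in auto)
      moreover have "(\<Sum>i\<in>{1..k0}. a i * (V i \<bullet> h + ?\<mu>)) = sum ?w {1..k0} + S * ?\<mu>"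
        by (simp add: distrib_left sum.distrib S_def sum_distrib_right)
      moreover have "S * ?\<mu> = sum ?w {k0 + 1..i0}"
        unfolding \<mu> using S Vy by (simp add: dual_adjoint_inner)
      moreover have "sum ?w {i0 + 1..CARD('d) + 1} \<le> 0"
      proof (rule sum_nonpos)
        fix i assume i: "i \<in> {i0 + 1..CARD('d) + 1}"
        then have "0 < a i" using a by auto
        moreover have "V i \<bullet> h \<le> 0" using V3[OF i] h by (simp add: normal_cone_def)
        ultimately show "?w i \<le> 0" by (simp add: mult_nonneg_nonpos)
      qed
      moreover have "sum ?w {1..CARD('d) + 1} =
          sum ?w {1..k0} + sum ?w {k0 + 1..i0} + sum ?w {i0 + 1..CARD('d) + 1}"
        using sum.ub_add_nat[of 1 k0 ?w "i0 - k0"] sum.ub_add_nat[of 1 i0 ?w "CARD('d) + 1 - i0"]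
          i0 k0 by simp
      moreover have "sum ?w {1..CARD('d) + 1} = 0"
        using arg_cong[OF dep, of "\<lambda>v. v \<bullet> h"]
        by (simp only: inner_sum_left inner_scaleR_left inner_zero_left)
      ultimately show False by simp
    qed
  qed
qed

section \<open>Local saddle points from the alternance\<close>

theorem theorem3:
  fixes A :: "(real ^ 'd) set"
    and K :: "'y::real_normed_vector set"
    and \<Lambda> :: "('y \<Rightarrow>\<^sub>L real) set"
    and m :: nat
    and f :: "nat \<Rightarrow> real ^ 'd \<Rightarrow> ereal"
    and G :: "real ^ 'd \<Rightarrow> 'y"
    and \<Phi> :: "'y \<Rightarrow> ('y \<Rightarrow>\<^sub>L real) \<Rightarrow> real \<Rightarrow> ereal"
    and \<Phi>\<^sub>0 :: "('y \<Rightarrow>\<^sub>L real) \<Rightarrow> ('y \<Rightarrow>\<^sub>L real)"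
    and DG :: "(real ^ 'd) \<Rightarrow>\<^sub>L 'y"
    and D2G :: "(real ^ 'd) \<Rightarrow>\<^sub>L (real ^ 'd) \<Rightarrow>\<^sub>L 'y"
    and xs :: "real ^ 'd"
  assumes "A \<noteq> {}" and "convex A"
    and "K \<noteq> {}" and "closed K" and "convex K" and "cone K"
    and "closed \<Lambda>" and "convex \<Lambda>" and "cone \<Lambda>" and "polar_cone K \<subseteq> \<Lambda>"
    and "1 \<le> m" and "\<And>k x. k \<in> {1..m} \<Longrightarrow> f k x \<noteq> -\<infinity>"
    and "\<And>y \<nu> c. 0 < c \<Longrightarrow> \<Phi> y \<nu> c \<noteq> -\<infinity>"
    and "\<exists>x\<in>feasible_set A G K. max_fun m f x < \<infinity>"
    and "\<exists>x. globally_optimal (max_fun m f) (feasible_set A G K) x"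
    and "locally_optimal (max_fun m f) (feasible_set A G K) xs"
    and "\<And>k. k \<in> {1..m} \<Longrightarrow> twice_differentiable_ereal_at (f k) xs"
    and "has_second_derivative_at G DG D2G xs"
    and "complete_alternance m f G DG A K xs"
    and "assumption_A2 \<Phi> K \<Lambda>"
    and "assumption_A4 \<Phi> \<Lambda>"
    and "assumption_A10 \<Phi> K"
    and "assumption_A11 \<Phi> \<Phi>\<^sub>0 K"
    and "\<And>\<nu>. \<nu> \<in> polar_cone K \<Longrightarrow> blinfun_apply \<nu> (G xs) = 0 \<Longrightarrow>
           second_order_expansion A K G DG D2G \<Phi> xs \<nu> (\<Phi>\<^sub>0 \<nu>)"
  shows "(\<exists>\<nu>s\<in>polar_cone K.
            local_saddle_point A \<Lambda> (augmented_lagrangian (max_fun m f) G \<Phi>) xs \<nu>s) \<and>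
         (\<forall>\<mu>s. KKT_pair (max_fun m f) G A K xs \<mu>s \<longrightarrow>
            (\<forall>\<nu>s\<in>polar_cone K. \<Phi>\<^sub>0 \<nu>s = \<mu>s \<longrightarrow>
               local_saddle_point A \<Lambda> (augmented_lagrangian (max_fun m f) G \<Phi>) xs \<nu>s))"
proof -
  let ?F = "max_fun m f"
  note m = \<open>1 \<le> m\<close> and f = assms(17) and A11 = \<open>assumption_A11 \<Phi> \<Phi>\<^sub>0 K\<close>
  have xA: "xs \<in> A" and GK: "G xs \<in> K" and Ffin: "?F xs < \<infinity>"
    using assms(16) by (auto simp: locally_optimal_def feasible_set_def)
  have fin: "\<forall>\<^sub>F z in nhds xs. \<bar>f k z\<bar> \<noteq> \<infinity>" if "k \<in> {1..m}" for k
    using f[OF that] by (simp add: twice_differentiable_ereal_at_def)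
  have "\<exists>D. ((\<lambda>z. real_of_ereal (f k z)) has_derivative D) (at xs)" if "k \<in> {1..m}" for k
    using f[OF that] has_second_derivative_atD
    unfolding twice_differentiable_ereal_at_def by blast
  then obtain D where D: "\<And>k. k \<in> {1..m} \<Longrightarrow>
      ((\<lambda>z. real_of_ereal (f k z)) has_derivative D k) (at xs)"
    by metis
  have DG: "(G has_derivative blinfun_apply DG) (at xs)"
    by (rule has_second_derivative_atD[OF assms(18)])
  have KKT: "KKT_pair ?F G A K xs \<mu> \<longleftrightarrow>
      xs \<in> A \<and> G xs \<in> K \<and> \<mu> \<in> polar_cone K \<and> blinfun_apply \<mu> (G xs) = 0 \<and>
      (\<forall>h\<in>contingent_cone A xs. \<exists>k\<in>active_indices m f xs.
         0 \<le> D k h + blinfun_apply \<mu> (blinfun_apply DG h))" for \<mu>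
    by (rule KKT_pair_iff[OF m fin D DG])
  have saddle: "local_saddle_point A \<Lambda> (augmented_lagrangian ?F G \<Phi>) xs \<nu>"
    if kkt: "KKT_pair ?F G A K xs \<mu>" and \<nu>: "\<nu> \<in> polar_cone K" and \<mu>: "\<Phi>\<^sub>0 \<nu> = \<mu>" for \<mu> \<nu>
  proof -
    \<comment> \<open>Complementarity is known for \<mu>; by (A11) the map
      \<open>\<Phi>\<^sub>0\<close> preserves it in both directions at points of
      \<open>K\<close>.\<close>
    have \<nu>0: "blinfun_apply \<nu> (G xs) = 0"
      using A11 kkt \<nu> \<mu> GK by (auto simp: assumption_A11_def KKT_pair_def)
    have \<nu>\<Lambda>: "\<nu> \<in> \<Lambda>" using \<nu> \<open>polar_cone K \<subseteq> \<Lambda>\<close> by blast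
    have zero: "\<Phi> (G xs) \<nu> c = 0" if "0 < c" for c
      using \<open>assumption_A10 \<Phi> K\<close> that \<nu> \<nu>0 GK by (simp add: assumption_A10_def)
    have "\<exists>c\<^sub>0>0. \<exists>U. open U \<and> xs \<in> U \<and>
        (\<forall>c\<ge>c\<^sub>0. \<forall>z\<in>U \<inter> A. ?F xs \<le> ?F z + \<Phi> (G z) \<nu> c)"
    proof (rule second_order_expansion_local_minimum[OF \<open>convex A\<close> xA m f D])
      show "second_order_expansion A K G DG D2G \<Phi> xs \<nu> \<mu>"
        using assms(24)[OF \<nu> \<nu>0] \<mu> by simp
      show "mono_on {0<..} (\<Phi> y \<nu>)" for y
        using \<open>assumption_A4 \<Phi> \<Lambda>\<close> \<nu>\<Lambda> by (simp add: assumption_A4_def)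
      have "((\<lambda>z. real_of_ereal (\<Phi> z \<nu> 1)) has_derivative blinfun_apply (\<Phi>\<^sub>0 \<nu>)) (at (G xs))"
        using A11 GK \<nu> \<nu>0 by (simp add: assumption_A11_def)
      then have c1: "isCont (\<lambda>z. real_of_ereal (\<Phi> z \<nu> 1)) (G (xs + 0))"
        using has_derivative_continuous by simp
      have "isCont G (xs + 0)" using has_derivative_continuous[OF DG] by simp
      moreover have "isCont (\<lambda>h. xs + h) 0" by simp
      ultimately have "isCont (\<lambda>h. G (xs + h)) 0"
        using isCont_o2[of 0 "\<lambda>h. xs + h" G] by simp
      then show "isCont (\<lambda>h. real_of_ereal (\<Phi> (G (xs + h)) \<nu> 1)) 0"
        using isCont_o2[of 0 "\<lambda>h. G (xs + h)" "\<lambda>z. real_of_ereal (\<Phi> z \<nu> 1)"] c1 by simp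
      show "\<exists>k\<in>active_indices m f xs. 0 \<le> D k h + blinfun_apply \<mu> (blinfun_apply DG h)"
        if "h \<in> contingent_cone A xs" for h
        using kkt that unfolding KKT by blast
      show "\<exists>k\<in>active_indices m f xs. 0 < D k h"
        if "h \<in> critical_cone A K G DG xs \<mu>" "h \<noteq> 0" for h
        by (rule complete_alternance_critical[OF assms(19) D that])
    qed (use zero in auto)
    then obtain c0 U where c0: "0 < c0" and U: "open U" "xs \<in> U"
      and min: "\<And>c z. c0 \<le> c \<Longrightarrow> z \<in> U \<inter> A \<Longrightarrow> ?F xs \<le> ?F z + \<Phi> (G z) \<nu> c"
      by blast
    \<comment> \<open>The left-hand saddle inequality: (A2) bounds every value at \<open>xs\<close>
      by the objective, and (A10) makes \<nu> attain this bound.\<close>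
    have "?F xs + \<Phi> (G xs) \<nu>' c \<le> ?F xs" if "c0 \<le> c" "\<nu>' \<in> \<Lambda>" for \<nu>' c
    proof -
      have "\<Phi> (G xs) \<nu>' c \<le> 0"
        using \<open>assumption_A2 \<Phi> K \<Lambda>\<close> GK that c0 by (simp add: assumption_A2_def)
      then have "?F xs + \<Phi> (G xs) \<nu>' c \<le> ?F xs + 0" by (rule add_left_mono)
      then show ?thesis by simp
    qed
    moreover have "\<Phi> (G xs) \<nu> c = 0" if "c0 \<le> c" for c
      using zero c0 that by simp
    ultimately show ?thesis
      unfolding local_saddle_point_def augmented_lagrangian_def
      using xA \<nu>\<Lambda> c0 U Ffin min by (auto intro!: exI[of _ c0] exI[of _ U] SUP_least INF_greatest)
  qed
  \<comment> \<open>For existence, the multiplier from the alternance gives a KKT-pair, and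
    surjectivity of \<open>\<Phi>\<^sub>0\<close> lifts it to some \<nu> in the polar cone.\<close>
  obtain \<mu> where "\<mu> \<in> polar_cone K" and "blinfun_apply \<mu> (G xs) = 0"
    and "\<And>h. h \<in> contingent_cone A xs \<Longrightarrow>
      \<exists>k\<in>active_indices m f xs. 0 \<le> D k h + blinfun_apply \<mu> (blinfun_apply DG h)"
    using complete_alternance_multiplier[of m f G DG A K xs D] assms(19) D by blast
  moreover from this(1) obtain \<nu> where "\<nu> \<in> polar_cone K" "\<Phi>\<^sub>0 \<nu> = \<mu>"
    using A11 by (metis assumption_A11_def imageE)
  ultimately have "\<exists>\<nu>s\<in>polar_cone K. local_saddle_point A \<Lambda> (augmented_lagrangian ?F G \<Phi>) xs \<nu>s"
    using saddle[of \<mu> \<nu>] xA GK unfolding KKT by blast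
  with saddle show ?thesis by blast
qed

end
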